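(* Let $\mathbb{G}$ be a homogeneous group of homogeneous dimension $Q\geq 2$ with a homogeneous quasi-norm $|\cdot|$. Let $1<p<\infty$ and $f\in C_{0}^{\infty}(\mathbb{G}\setminus\{0\})$, and for $R>0$ set $f_{R}(x)=f\left(R\frac{x}{|x|}\right)$. Then for any $R>0$ and any $q>1$ with $\frac1p+\frac1q=\frac12$ (when such $q$ exists), we have $$\left\|\frac{1}{|x|^{\frac{Q}{p}-1}}\mathcal{R}f\right\|_{L^{p}(\mathbb{G})}\|f\|_{L^{q}(\mathbb{G})}\geq\frac{p-1}{p}\left\|\frac{f(f-f_{R})}{|x|^{\frac{Q}{p}}\log\frac{R}{|x|}}\right\|_{L^{2}(\mathbb{G})},$$ and also, for any $R>0$ and with $\frac1p+\frac1{p'}=1$, $$\left\|\frac{1}{|x|^{\frac{Q}{p}-1}}\mathcal{R}f\right\|_{L^{p}(\mathbb{G})}\left\|\frac{f-f_{R}}{|x|^{\frac{Q}{p'}}\log\frac{R}{|x|}}\right\|_{L^{p'}(\mathbb{G})}\geq\frac{p-1}{p}\left\|\frac{f-f_{R}}{|x|^{\frac{Q}{2}}\log\frac{R}{|x|}}\right\|_{L^{2}(\mathbb{G})}^{2}.$$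
   Context: A homogeneous group $\mathbb{G}$ is a connected simply connected Lie group whose Lie algebra $\mathfrak{g}$ is equipped with a family of dilations $D_{\lambda}=\mathrm{Exp}(A\ln\lambda)=\sum_{k\ge 0}\frac{1}{k!}(\ln(\lambda)A)^{k}$, $\lambda>0$, where $A$ is a diagonalisable linear operator on $\mathfrak{g}$ with positive eigenvalues and each $D_{\lambda}$ is a Lie algebra morphism. Such a group is nilpotent, the exponential map $\mathfrak{g}\to\mathbb{G}$ is a global diffeomorphism, and the dilations are transported to $\mathbb{G}$ via it; write $\lambda x:=D_{\lambda}x$ for $x\in\mathbb{G}$. The unit element of $\mathbb{G}$ is denoted $0$. The homogeneous dimension is $Q=\mathrm{Tr}\,A$, and $dx$ denotes Haar measure; $L^p(\mathbb{G})$ is taken with respect to $dx$. A homogeneous quasi-norm is a continuous function $|\cdot|:\mathbb{G}\to[0,\infty)$ with $|x^{-1}|=|x|$, $|\lambda x|=\lambda|x|$ for all $x\in\mathbb{G}$, $\lambda>0$, and $|x|=0$ if and only if $x=0$. For $x\neq 0$ and $R>0$, $R\frac{x}{|x|}$ denotes $D_{R/|x|}x$. The radial operator $\mathcal{R}=\frac{d}{d|x|}$ is defined by $\mathcal{R}f(x)=\frac{d}{dr}f(D_{r}y)\big|_{r=|x|}$, where $y=D_{1/|x|}x$ (so $|y|=1$). Functions are complex-valued; $C_0^\infty(\mathbb{G}\setminus\{0\})$ denotes smooth functions with compact support in $\mathbb{G}\setminus\{0\}$. *)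

theory Defs
  imports "HOL-Analysis.Analysis"
begin

section \<open>Lie groups\<close>

text \<open>Smoothness on an open set. \<open>ck_on k S f\<close>: all iterated directional derivatives
  of \<open>f\<close> up to order \<open>k\<close> exist (as Frechet derivatives) and are continuous on the open set \<open>S\<close>.\<close>

primrec ck_on :: "nat \<Rightarrow> 'a::euclidean_space set \<Rightarrow> ('a \<Rightarrow> 'b::real_normed_vector) \<Rightarrow> bool" where
  "ck_on 0 = (\<lambda>S f. continuous_on S f)"
| "ck_on (Suc k) = (\<lambda>S f. (\<forall>x\<in>S. f differentiable (at x)) \<and>
      (\<forall>v. ck_on k S (\<lambda>x. frechet_derivative f (at x) v)))"

definition smooth_on :: "'a::euclidean_space set \<Rightarrow> ('a \<Rightarrow> 'b::real_normed_vector) \<Rightarrow> bool" where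
  "smooth_on S f \<longleftrightarrow> (\<forall>k. ck_on k S f)"

text \<open>A chart \<open>(U, \<phi>)\<close> maps the open set \<open>U\<close> homeomorphically onto an open subset of the model
  space; only the values of \<open>\<phi>\<close> on \<open>U\<close> matter. Its inverse is \<open>inv_into U \<phi>\<close>.\<close>

type_synonym ('g, 'a) chart = "'g set \<times> ('g \<Rightarrow> 'a)"

definition smooth_atlas :: "('g::topological_space, 'a::euclidean_space) chart set \<Rightarrow> bool" where
  "smooth_atlas \<A> \<longleftrightarrow>
     (\<Union>(U, \<phi>)\<in>\<A>. U) = UNIV \<and>
     (\<forall>(U, \<phi>)\<in>\<A>. open U \<and> open (\<phi> ` U) \<and> homeomorphism U (\<phi> ` U) \<phi> (inv_into U \<phi>)) \<and>
     (\<forall>(U, \<phi>)\<in>\<A>. \<forall>(V, \<psi>)\<in>\<A>. smooth_on (\<phi> ` (U \<inter> V)) (\<lambda>a. \<psi> (inv_into U \<phi> a)))"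

definition smooth_fun ::
    "('g::topological_space, 'a::euclidean_space) chart set \<Rightarrow> ('g \<Rightarrow> 'b::real_normed_vector) \<Rightarrow> bool" where
  "smooth_fun \<A> f \<longleftrightarrow> (\<forall>(U, \<phi>)\<in>\<A>. smooth_on (\<phi> ` U) (\<lambda>a. f (inv_into U \<phi> a)))"

definition diffeo_from_model ::
    "('g::topological_space, 'a::euclidean_space) chart set \<Rightarrow> ('a \<Rightarrow> 'g) \<Rightarrow> bool" where
  "diffeo_from_model \<A> e \<longleftrightarrow>
     homeomorphism UNIV UNIV e (inv e) \<and>
     (\<forall>(U, \<phi>)\<in>\<A>. smooth_on (e -` U) (\<lambda>v. \<phi> (e v))) \<and>
     smooth_fun \<A> (inv e)"

text \<open>The group law is written additively, following the class \<open>topological_group_add\<close>;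
  it is not assumed commutative. The unit is \<open>0\<close> and the inverse of \<open>x\<close> is \<open>- x\<close>.\<close>

definition lie_group ::
    "('g::{topological_group_add,t2_space,second_countable_topology}, 'a::euclidean_space) chart set \<Rightarrow> bool" where
  "lie_group \<A> \<longleftrightarrow>
     smooth_atlas \<A> \<and>
     (\<forall>(U, \<phi>)\<in>\<A>. \<forall>(V, \<psi>)\<in>\<A>. \<forall>(W, \<eta>)\<in>\<A>.
        smooth_on {(a, b). a \<in> \<phi> ` U \<and> b \<in> \<psi> ` V \<and> inv_into U \<phi> a + inv_into V \<psi> b \<in> W}
          (\<lambda>(a, b). \<eta> (inv_into U \<phi> a + inv_into V \<psi> b))) \<and>
     (\<forall>(U, \<phi>)\<in>\<A>. \<forall>(W, \<eta>)\<in>\<A>.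
        smooth_on {a. a \<in> \<phi> ` U \<and> - inv_into U \<phi> a \<in> W} (\<lambda>a. \<eta> (- inv_into U \<phi> a)))"


section \<open>Lie algebra and exponential map\<close>

type_synonym 'g vfield = "('g \<Rightarrow> real) \<Rightarrow> ('g \<Rightarrow> real)"

text \<open>Left-invariant vector fields as left-invariant derivations of the algebra of real smooth
  functions. The value on non-smooth arguments is fixed to be \<open>0\<close>, so that two vector fields are
  equal as HOL functions iff they agree on smooth functions.\<close>

definition left_invariant_fields ::
    "('g::{topological_group_add,t2_space,second_countable_topology}, 'a::euclidean_space) chart set
      \<Rightarrow> 'g vfield set" where
  "left_invariant_fields \<A> = {X.
     (\<forall>f. \<not> smooth_fun \<A> f \<longrightarrow> X f = (\<lambda>x. 0)) \<and>
     (\<forall>f. smooth_fun \<A> f \<longrightarrow> smooth_fun \<A> (X f)) \<and>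
     (\<forall>f g. smooth_fun \<A> f \<longrightarrow> smooth_fun \<A> g \<longrightarrow> X (\<lambda>x. f x + g x) = (\<lambda>x. X f x + X g x)) \<and>
     (\<forall>f c. smooth_fun \<A> f \<longrightarrow> X (\<lambda>x. c * f x) = (\<lambda>x. c * X f x)) \<and>
     (\<forall>f g. smooth_fun \<A> f \<longrightarrow> smooth_fun \<A> g \<longrightarrow>
        X (\<lambda>x. f x * g x) = (\<lambda>x. X f x * g x + f x * X g x)) \<and>
     (\<forall>f y. smooth_fun \<A> f \<longrightarrow> X (\<lambda>x. f (y + x)) = (\<lambda>x. X f (y + x)))}"

text \<open>The space \<open>'a\<close> is (a copy of) the Lie algebra: \<open>L\<close> is a linear isomorphism of \<open>'a\<close> onto the
  space of left-invariant vector fields. The inner product of \<open>'a\<close> plays no role.\<close>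

definition lie_algebra_iso ::
    "('g::{topological_group_add,t2_space,second_countable_topology}, 'a::euclidean_space) chart set
      \<Rightarrow> ('a \<Rightarrow> 'g vfield) \<Rightarrow> bool" where
  "lie_algebra_iso \<A> L \<longleftrightarrow>
     bij_betw L UNIV (left_invariant_fields \<A>) \<and>
     (\<forall>u v f x. L (u + v) f x = L u f x + L v f x) \<and>
     (\<forall>c v f x. L (c *\<^sub>R v) f x = c * L v f x)"

definition lie_bracket :: "('a \<Rightarrow> 'g vfield) \<Rightarrow> 'a \<Rightarrow> 'a \<Rightarrow> 'a" where
  "lie_bracket L u v = (THE w. \<forall>f x. L w f x = L u (L v f) x - L v (L u f) x)"

definition lie_algebra_morphism ::
    "('a::real_vector \<Rightarrow> 'g vfield) \<Rightarrow> ('a \<Rightarrow> 'a) \<Rightarrow> bool" where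
  "lie_algebra_morphism L D \<longleftrightarrow>
     linear D \<and> (\<forall>u v. D (lie_bracket L u v) = lie_bracket L (D u) (D v))"

text \<open>\<open>t \<mapsto> e (t v)\<close> is the one-parameter subgroup with velocity \<open>v\<close> at the unit; this determines
  \<open>e\<close> uniquely.\<close>

definition exponential_map ::
    "('g::{topological_group_add,t2_space,second_countable_topology}, 'a::euclidean_space) chart set
      \<Rightarrow> ('a \<Rightarrow> 'g vfield) \<Rightarrow> ('a \<Rightarrow> 'g) \<Rightarrow> bool" where
  "exponential_map \<A> L e \<longleftrightarrow> (\<forall>v.
     (\<forall>s t. e ((s + t) *\<^sub>R v) = e (s *\<^sub>R v) + e (t *\<^sub>R v)) \<and>
     (\<forall>f. smooth_fun \<A> f \<longrightarrow> ((\<lambda>t. f (e (t *\<^sub>R v))) has_real_derivative L v f 0) (at 0)))"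


section \<open>Homogeneous groups\<close>

definition diagonalisable :: "('a::real_vector \<Rightarrow> 'a) \<Rightarrow> bool" where
  "diagonalisable A \<longleftrightarrow>
     (\<exists>B. independent B \<and> span B = UNIV \<and> (\<forall>b\<in>B. \<exists>c. A b = c *\<^sub>R b))"

definition operator_trace :: "('a::euclidean_space \<Rightarrow> 'a) \<Rightarrow> real" where
  "operator_trace A = (\<Sum>b\<in>Basis. A b \<bullet> b)"

text \<open>\<open>D\<^sub>\<lambda> = Exp (A ln \<lambda>)\<close> on the Lie algebra, applied pointwise.\<close>

definition algebra_dilation :: "('a::euclidean_space \<Rightarrow> 'a) \<Rightarrow> real \<Rightarrow> 'a \<Rightarrow> 'a" where
  "algebra_dilation A r v = (\<Sum>k. (ln r ^ k / fact k) *\<^sub>R (A ^^ k) v)"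

text \<open>That the exponential map of such a group is a global diffeomorphism is a standard fact; it
  is recorded here because it is what allows the dilations to be transported to the group.\<close>

definition homogeneous_group ::
    "('g::{topological_group_add,t2_space,second_countable_topology}, 'a::euclidean_space) chart set
      \<Rightarrow> ('a \<Rightarrow> 'g vfield) \<Rightarrow> ('a \<Rightarrow> 'g) \<Rightarrow> ('a \<Rightarrow> 'a) \<Rightarrow> bool" where
  "homogeneous_group \<A> L e A \<longleftrightarrow>
     lie_group \<A> \<and> connected (UNIV :: 'g set) \<and> simply_connected (UNIV :: 'g set) \<and>
     lie_algebra_iso \<A> L \<and> exponential_map \<A> L e \<and> diffeo_from_model \<A> e \<and>
     linear A \<and> diagonalisable A \<and> (\<forall>c v. v \<noteq> 0 \<and> A v = c *\<^sub>R v \<longrightarrow> c > 0) \<and>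
     (\<forall>r>0. lie_algebra_morphism L (algebra_dilation A r))"

definition group_dilation ::
    "('a::euclidean_space \<Rightarrow> 'g) \<Rightarrow> ('a \<Rightarrow> 'a) \<Rightarrow> real \<Rightarrow> 'g \<Rightarrow> 'g" where
  "group_dilation e A r x = e (algebra_dilation A r (inv e x))"

definition homogeneous_quasi_norm ::
    "(real \<Rightarrow> 'g \<Rightarrow> 'g) \<Rightarrow> ('g::topological_group_add \<Rightarrow> real) \<Rightarrow> bool" where
  "homogeneous_quasi_norm \<delta> N \<longleftrightarrow>
     continuous_on UNIV N \<and> (\<forall>x. N x \<ge> 0) \<and> (\<forall>x. N (- x) = N x) \<and>
     (\<forall>x. \<forall>r>0. N (\<delta> r x) = r * N x) \<and> (\<forall>x. N x = 0 \<longleftrightarrow> x = 0)"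

text \<open>Left Haar measure. On a second countable locally compact space finiteness on compact sets
  already gives regularity, and homogeneous groups are unimodular.\<close>

definition haar_measure :: "'g::topological_group_add measure \<Rightarrow> bool" where
  "haar_measure M \<longleftrightarrow>
     sets M = sets borel \<and> emeasure M UNIV \<noteq> 0 \<and>
     (\<forall>K. compact K \<longrightarrow> emeasure M K < \<infinity>) \<and>
     (\<forall>y. \<forall>E\<in>sets M. emeasure M ((+) y ` E) = emeasure M E)"


section \<open>Function spaces and operators\<close>

definition test_functions ::
    "('g::topological_space, 'a::euclidean_space) chart set \<Rightarrow> 'g set \<Rightarrow> ('g \<Rightarrow> complex) set" where
  "test_functions \<A> S = {f. smooth_fun \<A> f \<and>
     compact (closure {x. f x \<noteq> 0}) \<and> closure {x. f x \<noteq> 0} \<subseteq> S}"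

text \<open>The \<open>L\<^sup>p\<close> norm with values in \<open>[0, \<infinity>]\<close>.\<close>

definition Lp_norm :: "'g measure \<Rightarrow> real \<Rightarrow> ('g \<Rightarrow> complex) \<Rightarrow> ennreal" where
  "Lp_norm M p h = (let I = (\<integral>\<^sup>+ x. ennreal (cmod (h x) powr p) \<partial>M) in
     if I = \<infinity> then \<infinity> else ennreal (enn2real I powr (1 / p)))"

definition radial_operator ::
    "(real \<Rightarrow> 'g \<Rightarrow> 'g) \<Rightarrow> ('g \<Rightarrow> real) \<Rightarrow> ('g \<Rightarrow> complex) \<Rightarrow> 'g \<Rightarrow> complex" where
  "radial_operator \<delta> N f x =
     vector_derivative (\<lambda>r. f (\<delta> r (\<delta> (1 / N x) x))) (at (N x))"

text \<open>\<open>f\<^sub>R(x) = f(R x/|x|)\<close>. At \<open>x = 0\<close>, and likewise for quotients by \<open>ln (R / N x)\<close> on the sphere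
  \<open>N x = R\<close>, HOL's totalised division yields irrelevant values on a null set.\<close>

definition radial_freeze ::
    "(real \<Rightarrow> 'g \<Rightarrow> 'g) \<Rightarrow> ('g \<Rightarrow> real) \<Rightarrow> real \<Rightarrow> ('g \<Rightarrow> complex) \<Rightarrow> 'g \<Rightarrow> complex" where
  "radial_freeze \<delta> N R f x = f (\<delta> (R / N x) x)"

end

(*
  In exponential coordinates the left-invariant fields form a frame "frame x", whose inverse
  satisfies along t |-> t u a linear ODE involving only the Lie bracket. Hence a dilation, being a
  Lie algebra morphism, intertwines frame x with frame (D x); letting D contract x to the unit gives
  det (frame x) = 1. So Lebesgue measure is left-invariant, Haar measure is a multiple of it by
  uniqueness, and D_r scales Haar measure by r^Q.

  The weight N^(-Q) then makes Haar measure invariant under the dilation flow, and Tonelli's theorem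
  reduces an integral over the group to one over flow orbits. In logarithmic time along an orbit the
  critical Hardy inequality
    (p - 1) / p * || (f - f_R) / (|x|^(Q/p) log (R/|x|)) ||_p <= || |x|^(1 - Q/p) Rf ||_p
  is Hardy's inequality on the line. Both claims follow from it by Hoelder's inequality.
*)

theory Submission
  imports Defs
begin

section \<open>Calculus of \<open>C\<^sup>k\<close> maps\<close>

text \<open>In exponential coordinates the straight lines through the origin are one-parameter
  subgroups. This is what closes the ODE along t u: \<open>frame (t *\<^sub>R u)\<close> fixes the
  direction u, so besides the bracket with u no further information on the group law enters it.

  Hardy's inequality can be used orbit by orbit because \<open>f\<^sub>R\<close> is constant on each
  orbit, equal to the value of f at the point where the orbit meets the sphere |x| = R. In
  logarithmic time t counted from that point, log (R / |x|) is - t, the difference of f and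
  \<open>f\<^sub>R\<close> vanishes at t = 0, and |x| Rf is the derivative in t. The constant (p /
  (p - 1))^p depends neither on the orbit nor on R, so it survives the integration over all orbits.
  The exponent Q / p is critical in that its p-th power exactly compensates the factor r^Q by which
  dilations scale Haar measure.\<close>

lemma frechet_derivative_cong_open:
  assumes "open S" "x \<in> S" "\<And>y. y \<in> S \<Longrightarrow> f y = g y"
  shows "frechet_derivative f (at x) = frechet_derivative g (at x)"
proof -
  have "(f has_derivative D) (at x) \<longleftrightarrow> (g has_derivative D) (at x)" for D
    using assms(3) by (auto elim!: has_derivative_transform_within_open[OF _ assms(1,2)])
  then show ?thesis unfolding frechet_derivative_def by simp
qed

text \<open>\<open>ck_on\<close> speaks of derivatives in the whole space, so agreement on
  \<open>S\<close> carries over to them because \<open>S\<close> is a neighbourhood of each of its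
  points.\<close>

lemma ck_on_cong:
  assumes "open S" "\<And>x. x \<in> S \<Longrightarrow> f x = g x"
  shows "ck_on k S f \<longleftrightarrow> ck_on k S g"
  using assms(2)
proof (induction k arbitrary: f g)
  case 0 then show ?case unfolding ck_on.simps by (intro continuous_on_cong) auto
next
  case (Suc k)
  have d: "f differentiable (at x) \<longleftrightarrow> g differentiable (at x)" if "x \<in> S" for x
    unfolding differentiable_def
    using Suc.prems that assms(1) by (metis (no_types, lifting) has_derivative_transform_within_open)
  have e: "frechet_derivative f (at x) v = frechet_derivative g (at x) v" if "x \<in> S" for x v
    using frechet_derivative_cong_open[OF assms(1) that Suc.prems] by simp
  have "ck_on k S (\<lambda>x. frechet_derivative f (at x) v) \<longleftrightarrow> ck_on k S (\<lambda>x. frechet_derivative g (at x) v)" for v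
    by (rule Suc.IH) (rule e)
  then show ?case using d by simp
qed

lemma ck_on_SucD: "ck_on (Suc k) S f \<Longrightarrow> ck_on k S f"
proof (induction k arbitrary: f)
  case 0 then show ?case
    by (auto intro!: continuous_at_imp_continuous_on differentiable_imp_continuous_within)
next
  case (Suc k)
  have "ck_on k S (\<lambda>x. frechet_derivative f (at x) v)" for v
    by (rule Suc.IH) (use Suc.prems in \<open>simp only: ck_on.simps, blast\<close>)
  moreover have "\<forall>x\<in>S. f differentiable (at x)" using Suc.prems by (simp only: ck_on.simps) blast
  ultimately show ?case by simp
qed

text \<open>The derivatives in \<open>ck_on\<close> are taken in the whole space rather than within
  \<open>S\<close>, so each clause can be checked near each point. This is how smoothness is pieced
  together from charts.\<close>

lemma ck_on_local:
  assumes "\<And>x. x \<in> S \<Longrightarrow> \<exists>T. open T \<and> x \<in> T \<and> ck_on k T f"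
  shows "ck_on k S f"
  using assms
proof (induction k arbitrary: f)
  case 0
  have "isCont f x" if "x \<in> S" for x
    using 0[OF that] by (auto simp: continuous_on_eq_continuous_at)
  then show ?case by (simp add: continuous_at_imp_continuous_on)
next
  case (Suc k)
  have "ck_on k S (\<lambda>x. frechet_derivative f (at x) v)" for v
    by (rule Suc.IH) (use Suc.prems in \<open>simp only: ck_on.simps, blast\<close>)
  moreover have "f differentiable (at x)" if "x \<in> S" for x
    using Suc.prems[OF that] by auto
  ultimately show ?case by simp
qed

lemma ck_on_const: "ck_on k S (\<lambda>x. c)"
  by (induction k arbitrary: c) auto

lemma ck_on_add:
  assumes "open S" "ck_on k S f" "ck_on k S g"
  shows "ck_on k S (\<lambda>x. f x + g x)"
  using assms(2,3)
proof (induction k arbitrary: f g)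
  case 0 then show ?case by (auto intro: continuous_on_add)
next
  case (Suc k)
  have "ck_on k S (\<lambda>x. frechet_derivative (\<lambda>x. f x + g x) (at x) v)" for v
  proof -
    have "ck_on k S (\<lambda>x. frechet_derivative f (at x) v + frechet_derivative g (at x) v)"
      using Suc by auto
    moreover have "frechet_derivative (\<lambda>x. f x + g x) (at x) v
        = frechet_derivative f (at x) v + frechet_derivative g (at x) v" if "x \<in> S" for x
    proof -
      have "((\<lambda>x. f x + g x) has_derivative (\<lambda>v. frechet_derivative f (at x) v + frechet_derivative g (at x) v)) (at x)"
        using Suc.prems that by (auto intro!: has_derivative_add simp: frechet_derivative_works[symmetric])
      from frechet_derivative_at[OF this] show ?thesis by metis
    qed
    ultimately show ?thesis by (subst ck_on_cong[OF assms(1)]) auto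
  qed
  then show ?case using Suc.prems by (auto intro: differentiable_add)
qed

text \<open>Product rule: in each summand one factor has lost a derivative, and the other is brought
  down to the same order by \<open>ck_on_SucD\<close>. A general bilinear map covers products,
  scalar multiples and inner products at once.\<close>

lemma ck_on_bilinear:
  assumes "bounded_bilinear h" "open S" "ck_on k S f" "ck_on k S g"
  shows "ck_on k S (\<lambda>x. h (f x) (g x))"
  using assms(3,4)
proof (induction k arbitrary: f g)
  case 0 then show ?case by (auto intro: bounded_bilinear.continuous_on[OF assms(1)])
next
  case (Suc k)
  have D: "((\<lambda>x. h (f x) (g x)) has_derivative (\<lambda>v. h (f x) (frechet_derivative g (at x) v)
      + h (frechet_derivative f (at x) v) (g x))) (at x)" if "x \<in> S" for x
    using Suc.prems that
    by (auto intro!: bounded_bilinear.FDERIV[OF assms(1)] simp: frechet_derivative_works[symmetric])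
  have "ck_on k S (\<lambda>x. frechet_derivative (\<lambda>x. h (f x) (g x)) (at x) v)" for v
  proof -
    have "ck_on k S (\<lambda>x. h (f x) (frechet_derivative g (at x) v) + h (frechet_derivative f (at x) v) (g x))"
      by (rule ck_on_add[OF assms(2) Suc.IH[OF ck_on_SucD[OF Suc.prems(1)]] Suc.IH[OF _ ck_on_SucD[OF Suc.prems(2)]]])
        (use Suc.prems in simp_all)
    moreover have "frechet_derivative (\<lambda>x. h (f x) (g x)) (at x) v
        = h (f x) (frechet_derivative g (at x) v) + h (frechet_derivative f (at x) v) (g x)" if "x \<in> S" for x
      using frechet_derivative_at[OF D[OF that]] by metis
    ultimately show ?thesis by (subst ck_on_cong[OF assms(2)]) auto
  qed
  then show ?case using D by (auto simp: differentiable_def)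
qed

lemma ck_on_bounded_linear:
  assumes "bounded_linear h" shows "ck_on k S h"
proof (cases k)
  case 0 then show ?thesis using assms by (simp add: linear_continuous_on)
next
  case (Suc j)
  have "frechet_derivative h (at x) = h" for x
    using frechet_derivative_at[OF bounded_linear_imp_has_derivative[OF assms]] by metis
  then show ?thesis using Suc assms by (auto simp: ck_on_const bounded_linear_imp_differentiable)
qed

lemma ck_on_sum:
  assumes "open S" "finite I" "\<And>i. i \<in> I \<Longrightarrow> ck_on k S (f i)"
  shows "ck_on k S (\<lambda>x. \<Sum>i\<in>I. f i x)"
  using assms(2,3)
  by (induction I rule: finite_induct) (auto intro: ck_on_const ck_on_add[OF assms(1)])

lemma frechet_derivative_euclidean:
  fixes f :: "'a::euclidean_space \<Rightarrow> 'b::real_normed_vector"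
  assumes "f differentiable (at x)"
  shows "frechet_derivative f (at x) v = (\<Sum>b\<in>Basis. (v \<bullet> b) *\<^sub>R frechet_derivative f (at x) b)"
proof -
  have l: "linear (frechet_derivative f (at x))" by (rule linear_frechet_derivative[OF assms])
  have "frechet_derivative f (at x) (\<Sum>b\<in>Basis. (v \<bullet> b) *\<^sub>R b)
      = (\<Sum>b\<in>Basis. (v \<bullet> b) *\<^sub>R frechet_derivative f (at x) b)"
    by (simp add: linear_sum[OF l] linear_cmul[OF l])
  then show ?thesis by (simp add: euclidean_representation)
qed

text \<open>The chain rule differentiates \<open>f\<close> in the direction
  \<open>frechet_derivative g (at x) v\<close>, which moves with \<open>x\<close>, whereas
  \<open>ck_on\<close> controls fixed directions. Expanding that vector in \<open>Basis\<close>
  leads back to fixed directions; the induction keeps \<open>g\<close> and applies to the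
  directional derivatives of \<open>f\<close>.\<close>

lemma ck_on_compose:
  fixes g :: "'a::euclidean_space \<Rightarrow> 'b::euclidean_space" and f :: "'b \<Rightarrow> 'c::real_normed_vector"
  assumes "open S" "open T" "g ` S \<subseteq> T" "ck_on k T f" "ck_on k S g"
  shows "ck_on k S (\<lambda>x. f (g x))"
  using assms(4,5)
proof (induction k arbitrary: f)
  case 0 then show ?case using continuous_on_compose2[of T f S g] assms(3) by simp
next
  case (Suc k)
  have D: "((\<lambda>x. f (g x)) has_derivative (\<lambda>v. frechet_derivative f (at (g x)) (frechet_derivative g (at x) v))) (at x)"
    if "x \<in> S" for x
    by (rule has_derivative_compose)
      (use Suc.prems assms(3) that in \<open>auto simp: frechet_derivative_works[symmetric]\<close>)
  have "ck_on k S (\<lambda>x. frechet_derivative (\<lambda>x. f (g x)) (at x) v)" for v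
  proof -
    have g: "ck_on k S g" by (rule ck_on_SucD[OF Suc.prems(2)])
    have "ck_on k S (\<lambda>x. frechet_derivative g (at x) v \<bullet> b)" for b
      by (rule ck_on_bilinear[OF bounded_bilinear_inner assms(1) _ ck_on_const]) (use Suc.prems in simp)
    moreover have "ck_on k S (\<lambda>x. frechet_derivative f (at (g x)) b)" for b
      by (rule Suc.IH[OF _ g]) (use Suc.prems in simp)
    ultimately have "ck_on k S (\<lambda>x. \<Sum>b\<in>Basis. (frechet_derivative g (at x) v \<bullet> b) *\<^sub>R frechet_derivative f (at (g x)) b)"
      by - (rule ck_on_sum[OF assms(1) finite_Basis], rule ck_on_bilinear[OF bounded_bilinear_scaleR assms(1)])
    moreover have "frechet_derivative (\<lambda>x. f (g x)) (at x) v =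
        (\<Sum>b\<in>Basis. (frechet_derivative g (at x) v \<bullet> b) *\<^sub>R frechet_derivative f (at (g x)) b)" if "x \<in> S" for x
    proof -
      have "f differentiable (at (g x))" using Suc.prems(1) assms(3) that by auto
      then show ?thesis
        by (simp flip: frechet_derivative_at[OF D[OF that]] add: frechet_derivative_euclidean[of f])
    qed
    ultimately show ?thesis by (subst ck_on_cong[OF assms(1)]) auto
  qed
  then show ?case using D by (auto simp: differentiable_def)
qed

section \<open>Closure properties of smooth maps\<close>

lemma smooth_on_cong: "open S \<Longrightarrow> (\<And>x. x \<in> S \<Longrightarrow> f x = g x) \<Longrightarrow> smooth_on S f \<longleftrightarrow> smooth_on S g"
  unfolding smooth_on_def by (simp cong: ck_on_cong)

lemma smooth_on_local:
  assumes "\<And>x. x \<in> S \<Longrightarrow> \<exists>T. open T \<and> x \<in> T \<and> smooth_on T f"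
  shows "smooth_on S f"
  unfolding smooth_on_def
proof
  fix k show "ck_on k S f" by (rule ck_on_local) (use assms in \<open>auto simp: smooth_on_def\<close>)
qed

lemma smooth_on_const: "smooth_on S (\<lambda>x. c)"
  by (simp add: smooth_on_def ck_on_const)

lemma smooth_on_add:
  "open S \<Longrightarrow> smooth_on S f \<Longrightarrow> smooth_on S g \<Longrightarrow> smooth_on S (\<lambda>x. f x + g x)"
  by (simp add: smooth_on_def ck_on_add)

lemma smooth_on_bilinear:
  "bounded_bilinear h \<Longrightarrow> open S \<Longrightarrow> smooth_on S f \<Longrightarrow> smooth_on S g \<Longrightarrow> smooth_on S (\<lambda>x. h (f x) (g x))"
  by (simp add: smooth_on_def ck_on_bilinear)

lemma smooth_on_bounded_linear: "bounded_linear h \<Longrightarrow> smooth_on S h"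
  by (simp add: smooth_on_def ck_on_bounded_linear)

lemma smooth_on_compose:
  fixes g :: "'a::euclidean_space \<Rightarrow> 'b::euclidean_space"
  shows "open S \<Longrightarrow> open T \<Longrightarrow> g ` S \<subseteq> T \<Longrightarrow> smooth_on T f \<Longrightarrow> smooth_on S g
    \<Longrightarrow> smooth_on S (\<lambda>x. f (g x))"
  by (simp add: smooth_on_def ck_on_compose)

lemma smooth_on_compose_UNIV:
  fixes g :: "'a::euclidean_space \<Rightarrow> 'b::euclidean_space"
  shows "smooth_on UNIV f \<Longrightarrow> smooth_on UNIV g \<Longrightarrow> smooth_on UNIV (\<lambda>x. f (g x))"
  by (rule smooth_on_compose[of UNIV UNIV]) auto

lemma smooth_on_Pair:
  fixes f :: "'a::euclidean_space \<Rightarrow> 'b::euclidean_space" and g :: "'a \<Rightarrow> 'c::euclidean_space"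
  assumes "open S" "smooth_on S f" "smooth_on S g"
  shows "smooth_on S (\<lambda>x. (f x, g x))"
proof -
  have "smooth_on S (\<lambda>x. (f x, 0))"
    by (rule smooth_on_compose[where T=UNIV and f="\<lambda>y. (y, 0)" and g=f])
      (use assms in \<open>auto intro!: smooth_on_bounded_linear bounded_linear_Pair bounded_linear_ident bounded_linear_zero\<close>)
  moreover have "smooth_on S (\<lambda>x. (0, g x))"
    by (rule smooth_on_compose[where T=UNIV and f="\<lambda>y. (0, y)" and g=g])
      (use assms in \<open>auto intro!: smooth_on_bounded_linear bounded_linear_Pair bounded_linear_ident bounded_linear_zero\<close>)
  ultimately have "smooth_on S (\<lambda>x. (f x, 0) + (0, g x))"
    by (rule smooth_on_add[OF assms(1)])
  then show ?thesis by simp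
qed

lemma smooth_on_imp_differentiable: "smooth_on S f \<Longrightarrow> x \<in> S \<Longrightarrow> f differentiable (at x)"
  unfolding smooth_on_def by (drule spec[of _ "Suc 0"]) simp

lemma smooth_on_imp_has_derivative:
  "smooth_on S f \<Longrightarrow> x \<in> S \<Longrightarrow> (f has_derivative frechet_derivative f (at x)) (at x)"
  using smooth_on_imp_differentiable frechet_derivative_works by blast

lemma smooth_on_imp_continuous_on: "smooth_on S f \<Longrightarrow> continuous_on S f"
  unfolding smooth_on_def by (drule spec[of _ 0]) simp

lemma smooth_on_frechet_derivative: "smooth_on S f \<Longrightarrow> smooth_on S (\<lambda>x. frechet_derivative f (at x) v)"
  unfolding smooth_on_def
proof
  fix k assume "\<forall>k. ck_on k S f"
  then have "ck_on (Suc k) S f" by blast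
  then show "ck_on k S (\<lambda>x. frechet_derivative f (at x) v)" by simp
qed

section \<open>Smooth group laws in exponential coordinates\<close>

text \<open>Gronwall's argument: with \<open>C\<close> a bound for \<open>F\<close>, the squared
  norm of \<open>y\<close> damped by exp (- 2 C t) cannot increase, and it starts at zero.\<close>

lemma linear_ode_zero:
  fixes y :: "real \<Rightarrow> 'a::real_inner"
  assumes "bounded_linear F" "y 0 = 0" "\<And>t. (y has_vector_derivative F (y t)) (at t)" "0 \<le> t"
  shows "y t = 0"
proof -
  obtain C where C: "\<And>x. norm (F x) \<le> norm x * C"
    using bounded_linear.bounded[OF assms(1)] by blast
  define \<phi> where "\<phi> s = (y s \<bullet> y s) * exp (- 2 * C * s)" for s
  have D: "(\<phi> has_real_derivative 2 * (y s \<bullet> F (y s) - C * (y s \<bullet> y s)) * exp (- 2 * C * s)) (at s)" for s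
  proof -
    have "((\<lambda>s. y s \<bullet> y s) has_real_derivative 2 * (y s \<bullet> F (y s))) (at s)"
    proof -
      have "(y has_derivative (\<lambda>h. h *\<^sub>R F (y s))) (at s)"
        using assms(3)[of s] by (simp add: has_vector_derivative_def)
      then show ?thesis
        unfolding has_field_derivative_def
        by (intro has_derivative_eq_rhs[OF has_derivative_inner])
          (auto simp: fun_eq_iff inner_commute[of "F (y s)"])
    qed
    then show ?thesis unfolding \<phi>_def
      by (auto intro!: derivative_eq_intros simp: algebra_simps)
  qed
  have "\<phi> t \<le> \<phi> 0"
  proof (rule DERIV_nonpos_imp_nonincreasing[OF assms(4)])
    fix s
    have "y s \<bullet> F (y s) \<le> norm (y s) * norm (F (y s))" by (rule norm_cauchy_schwarz)
    also have "\<dots> \<le> norm (y s) * (norm (y s) * C)" by (intro mult_left_mono C) auto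
    also have "\<dots> = C * (y s \<bullet> y s)" by (simp add: power2_norm_eq_inner[symmetric] power2_eq_square)
    finally have "2 * (y s \<bullet> F (y s) - C * (y s \<bullet> y s)) * exp (- 2 * C * s) \<le> 0"
      by (simp add: mult_nonpos_nonneg)
    with D show "\<exists>z. DERIV \<phi> s :> z \<and> z \<le> 0" by blast
  qed
  then have "(y t \<bullet> y t) * exp (- 2 * C * t) \<le> 0" using assms(2) by (simp add: \<phi>_def)
  then have "y t \<bullet> y t \<le> 0" by (simp add: mult_le_0_iff)
  then show ?thesis by (metis inner_eq_zero_iff inner_ge_zero order_antisym)
qed

text \<open>A group law on the Lie algebra for which the lines through the origin are one-parameter
  subgroups. That axiom already makes 0 the unit and \<open>- x\<close> the inverse of
  \<open>x\<close>.\<close>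

locale exponential_law =
  fixes m :: "'a::euclidean_space \<Rightarrow> 'a \<Rightarrow> 'a"
  assumes smooth: "smooth_on UNIV (\<lambda>z. m (fst z) (snd z))"
    and assoc: "m (m x y) z = m x (m y z)"
    and multiples: "m (s *\<^sub>R x) (t *\<^sub>R x) = (s + t) *\<^sub>R x"
begin

lemma zero_right [simp]: "m x 0 = x" using multiples[of 1 x 0] by simp
lemma zero_left [simp]: "m 0 x = x" using multiples[of 0 x 1] by simp
lemma inverse_right [simp]: "m x (- x) = 0" using multiples[of 1 x "-1"] by simp
lemma inverse_left [simp]: "m (- x) x = 0" using multiples[of "-1" x 1] by simp
lemma cancel_left [simp]: "m (- x) (m x y) = y" by (simp flip: assoc)
lemma cancel_left' [simp]: "m x (m (- x) y) = y" by (simp flip: assoc)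

text \<open>The differential at \<open>y\<close> of left translation by \<open>x\<close>, cut out of
  the differential of the joint map so that it inherits smoothness in both \<open>x\<close> and
  \<open>y\<close>.\<close>

definition translation_derivative :: "'a \<Rightarrow> 'a \<Rightarrow> 'a \<Rightarrow> 'a" where
  "translation_derivative x y w = frechet_derivative (\<lambda>z. m (fst z) (snd z)) (at (x, y)) (0, w)"

text \<open>\<open>\<lambda>x. frame x w\<close> is the left-invariant vector field with value \<open>w\<close> at the unit.\<close>

definition frame :: "'a \<Rightarrow> 'a \<Rightarrow> 'a" where
  "frame x = translation_derivative x 0"

text \<open>The inverse of \<open>frame x\<close>, namely the differential at \<open>x\<close> of
  translation by \<open>- x\<close>. In this form its smoothness in \<open>x\<close> is inherited
  from the law, with no matrix to invert.\<close>

definition coframe :: "'a \<Rightarrow> 'a \<Rightarrow> 'a" where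
  "coframe x = translation_derivative (- x) x"

lemma has_derivative_translation: "(m x has_derivative translation_derivative x y) (at y)"
proof -
  have "((\<lambda>z. m (fst z) (snd z)) has_derivative frechet_derivative (\<lambda>z. m (fst z) (snd z)) (at (x, y))) (at (x, y))"
    by (rule smooth_on_imp_has_derivative[OF smooth]) simp
  moreover have "(Pair x has_derivative (\<lambda>w. (0, w))) (at y)"
    by (auto intro!: derivative_eq_intros)
  ultimately have "((\<lambda>y. m x y) has_derivative (\<lambda>w. frechet_derivative (\<lambda>z. m (fst z) (snd z)) (at (x, y)) (0, w))) (at y)"
    using has_derivative_compose[where f="Pair x" and x = y and s=UNIV] by force
  then show ?thesis by (simp add: translation_derivative_def[abs_def])
qed

lemma bounded_linear_translation: "bounded_linear (translation_derivative x y)"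
  using has_derivative_translation by (rule has_derivative_bounded_linear)

text \<open>The chain rule applied to associativity: translation by \<open>m x y\<close> is
  translation by \<open>y\<close> followed by translation by \<open>x\<close>.\<close>

lemma translation_derivative_comp:
  "translation_derivative x (m y z) (translation_derivative y z w) = translation_derivative (m x y) z w"
proof -
  have "((\<lambda>z. m x (m y z)) has_derivative (\<lambda>w. translation_derivative x (m y z) (translation_derivative y z w))) (at z)"
    by (rule has_derivative_compose[OF has_derivative_translation has_derivative_translation])
  moreover have "((\<lambda>z. m x (m y z)) has_derivative translation_derivative (m x y) z) (at z)"
  proof -
    have "(\<lambda>z. m x (m y z)) = m (m x y)" by (simp add: fun_eq_iff assoc)
    then show ?thesis using has_derivative_translation by simp
  qed
  ultimately show ?thesis using has_derivative_unique by metis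
qed

lemma translation_derivative_zero: "translation_derivative 0 y w = w"
proof -
  have "((\<lambda>y. y) has_derivative translation_derivative 0 y) (at y)"
  proof -
    have "(\<lambda>y. y) = m 0" by (simp add: fun_eq_iff)
    then show ?thesis using has_derivative_translation by simp
  qed
  then show ?thesis using has_derivative_unique has_derivative_ident by metis
qed

lemma frame_zero [simp]: "frame 0 w = w"
  by (simp add: frame_def translation_derivative_zero)

lemma translation_frame: "translation_derivative x y (frame y w) = frame (m x y) w"
  unfolding frame_def using translation_derivative_comp[of x y 0 w] by simp

lemma coframe_frame [simp]: "coframe x (frame x w) = w"
  by (simp add: coframe_def translation_frame)

lemma frame_coframe [simp]: "frame x (coframe x w) = w"
  unfolding coframe_def frame_def
  using translation_derivative_comp[of x "- x" x w] by (simp add: translation_derivative_zero)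

lemma bounded_linear_frame: "bounded_linear (frame x)"
  unfolding frame_def by (rule bounded_linear_translation)

lemma smooth_frame: "smooth_on UNIV (\<lambda>x. frame x w)"
  unfolding frame_def translation_derivative_def
  by (rule smooth_on_compose_UNIV[OF smooth_on_frechet_derivative[OF smooth]])
    (auto intro!: smooth_on_bounded_linear bounded_linear_Pair bounded_linear_ident bounded_linear_zero)

lemma smooth_coframe: "smooth_on UNIV (\<lambda>x. coframe x w)"
  unfolding coframe_def translation_derivative_def
  by (rule smooth_on_compose_UNIV[OF smooth_on_frechet_derivative[OF smooth]])
    (auto intro!: smooth_on_bounded_linear bounded_linear_Pair bounded_linear_ident bounded_linear_minus)

text \<open>This is the derivative of \<open>m x (t *\<^sub>R x) = (1 + t) *\<^sub>R x\<close> at t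
  = 0: the left-invariant field with value \<open>x\<close> at the unit is tangent to the line
  through \<open>x\<close>.\<close>

lemma frame_self [simp]: "frame x x = x"
proof -
  have "(m x has_derivative frame x) (at (0 *\<^sub>R x))"
    using has_derivative_translation[of x 0] by (simp add: frame_def)
  moreover have "((\<lambda>t. t *\<^sub>R x) has_derivative (\<lambda>t. t *\<^sub>R x)) (at (0::real))"
    by (auto intro!: derivative_eq_intros)
  ultimately have "((\<lambda>t. m x (t *\<^sub>R x)) has_derivative (\<lambda>t. frame x (t *\<^sub>R x))) (at 0)"
    using has_derivative_compose by blast
  moreover have "((\<lambda>t. m x (t *\<^sub>R x)) has_derivative (\<lambda>t. t *\<^sub>R x)) (at (0::real))"
    using multiples[of 1 x] by (auto intro!: derivative_eq_intros)
  ultimately have "(\<lambda>t. frame x (t *\<^sub>R x)) = (\<lambda>t. t *\<^sub>R x)" by (rule has_derivative_unique)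
  from fun_cong[OF this, of 1] show ?thesis by simp
qed

lemma frame_scaleR [simp]: "frame (t *\<^sub>R x) x = x"
proof (cases "t = 0")
  case False
  have "t *\<^sub>R frame (t *\<^sub>R x) x = t *\<^sub>R x"
    using frame_self[of "t *\<^sub>R x"] linear_cmul[OF bounded_linear.linear[OF bounded_linear_frame]] by metis
  with False show ?thesis by simp
qed simp

lemma frame_euclidean: "frame x w = (\<Sum>b\<in>Basis. (w \<bullet> b) *\<^sub>R frame x b)"
proof -
  have "frame x (\<Sum>b\<in>Basis. (w \<bullet> b) *\<^sub>R b) = (\<Sum>b\<in>Basis. (w \<bullet> b) *\<^sub>R frame x b)"
    using bounded_linear.linear[OF bounded_linear_frame] by (simp add: linear_sum linear_cmul)
  then show ?thesis by (simp add: euclidean_representation)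
qed

section \<open>Derivative of the frame in the base point\<close>

definition dframe :: "'a \<Rightarrow> 'a \<Rightarrow> 'a \<Rightarrow> 'a" where
  "dframe x w u = frechet_derivative (\<lambda>x. frame x w) (at x) u"

lemma has_derivative_frame: "((\<lambda>x. frame x w) has_derivative dframe x w) (at x)"
  using smooth_on_imp_has_derivative[OF smooth_frame] by (simp add: dframe_def[abs_def])

lemma linear_dframe: "linear (dframe x w)"
  using has_derivative_frame has_derivative_linear by blast

lemma dframe_euclidean: "dframe x w u = (\<Sum>b\<in>Basis. (w \<bullet> b) *\<^sub>R dframe x b u)"
proof -
  have "((\<lambda>x. \<Sum>b\<in>Basis. (w \<bullet> b) *\<^sub>R frame x b) has_derivative (\<lambda>u. \<Sum>b\<in>Basis. (w \<bullet> b) *\<^sub>R dframe x b u)) (at x)"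
    by (intro has_derivative_sum has_derivative_scaleR_right has_derivative_frame)
  then have "((\<lambda>x. frame x w) has_derivative (\<lambda>u. \<Sum>b\<in>Basis. (w \<bullet> b) *\<^sub>R dframe x b u)) (at x)"
    by (simp flip: frame_euclidean)
  then show ?thesis using has_derivative_unique[OF has_derivative_frame] by metis
qed

lemma linear_dframe_left: "linear (\<lambda>w. dframe x w u)"
proof -
  have "linear (\<lambda>w. \<Sum>b\<in>Basis. (w \<bullet> b) *\<^sub>R dframe x b u)"
    by (rule linearI) (simp_all add: inner_add_left scaleR_left_distrib sum.distrib scaleR_sum_right)
  then show ?thesis by (simp flip: dframe_euclidean)
qed

text \<open>Leibniz rule for a moving base point and a moving vector. Expanding the vector in
  \<open>Basis\<close> leaves scalar multiples of the curves \<open>frame (c t) b\<close>.\<close>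

lemma frame_along_curve:
  assumes "(c has_vector_derivative c') (at t)" "(J has_vector_derivative J') (at t)"
  shows "((\<lambda>t. frame (c t) (J t)) has_vector_derivative frame (c t) J' + dframe (c t) (J t) c') (at t)"
proof -
  have f: "((\<lambda>t. frame (c t) b) has_vector_derivative dframe (c t) b c') (at t)" for b
  proof -
    have "(c has_derivative (\<lambda>h. h *\<^sub>R c')) (at t)" using assms(1) by (simp add: has_vector_derivative_def)
    from has_derivative_compose[OF this has_derivative_frame] show ?thesis
      using linear_cmul[OF linear_dframe] by (simp add: has_vector_derivative_def)
  qed
  have j: "((\<lambda>t. J t \<bullet> b) has_real_derivative J' \<bullet> b) (at t)" for b
    using bounded_linear.has_vector_derivative[OF bounded_linear_inner_left assms(2)]
    by (simp add: has_real_derivative_iff_has_vector_derivative)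
  have "((\<lambda>t. \<Sum>b\<in>Basis. (J t \<bullet> b) *\<^sub>R frame (c t) b) has_vector_derivative
      (\<Sum>b\<in>Basis. (J t \<bullet> b) *\<^sub>R dframe (c t) b c' + (J' \<bullet> b) *\<^sub>R frame (c t) b)) (at t)"
    by (intro has_vector_derivative_sum has_vector_derivative_scaleR f j)
  moreover have "(\<Sum>b\<in>Basis. (J t \<bullet> b) *\<^sub>R dframe (c t) b c' + (J' \<bullet> b) *\<^sub>R frame (c t) b)
     = frame (c t) J' + dframe (c t) (J t) c'"
    by (simp add: sum.distrib flip: frame_euclidean dframe_euclidean)
  ultimately show ?thesis by (simp flip: frame_euclidean)
qed

text \<open>Obtained by differentiating the identity \<open>frame y y = y\<close> along
  \<open>y = x + s *\<^sub>R v\<close>. It evaluates the term of the bracket formula that is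
  differentiated transversally to the line through \<open>x\<close>.\<close>

lemma dframe_self: "dframe x x v = v - frame x v"
proof -
  have c: "((\<lambda>s. x + s *\<^sub>R v) has_vector_derivative v) (at 0)"
    by (auto intro!: derivative_eq_intros)
  have "((\<lambda>s. x + s *\<^sub>R v) has_vector_derivative frame x v + dframe x x v) (at 0)"
    using frame_along_curve[OF c c] by simp
  from vector_derivative_unique_at[OF c this] show ?thesis by (simp add: algebra_simps)
qed

end

text \<open>The bracket is that of vector fields: the right-hand side is the commutator of the
  left-invariant fields with values \<open>u\<close> and \<open>v\<close> at the unit, with the sign
  of X Y - Y X for fields acting as derivations.\<close>

locale exponential_law_bracket = exponential_law m for m :: "'a::euclidean_space \<Rightarrow> 'a \<Rightarrow> 'a" +
  fixes br :: "'a \<Rightarrow> 'a \<Rightarrow> 'a"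
  assumes frame_bracket: "frame x (br u v) = dframe x v (frame x u) - dframe x u (frame x v)"
begin

lemma bounded_linear_bracket: "bounded_linear (br u)"
proof -
  have "br u = (\<lambda>v. dframe 0 v u - dframe 0 u v)" using frame_bracket[of 0 u] by auto
  moreover have "linear (\<lambda>v. dframe 0 v u - dframe 0 u v)"
    by (intro linear_compose_sub linear_dframe linear_dframe_left)
  ultimately show ?thesis using linear_conv_bounded_linear by metis
qed

text \<open>\<open>t *\<^sub>R coframe (t *\<^sub>R u) v\<close> is the left-trivialised differential of the exponential map
  along \<open>t \<mapsto> t *\<^sub>R u\<close>. This equation determines it from the bracket alone.\<close>

lemma coframe_ode:
  "((\<lambda>t. t *\<^sub>R coframe (t *\<^sub>R u) v) has_vector_derivative v - br u (t *\<^sub>R coframe (t *\<^sub>R u) v)) (at t)"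
proof -
  define J where "J t = t *\<^sub>R coframe (t *\<^sub>R u) v" for t
  have c: "((\<lambda>t. t *\<^sub>R u) has_vector_derivative u) (at t)" for t
    by (auto intro!: derivative_eq_intros)
  have "(\<lambda>t. coframe (t *\<^sub>R u) v) differentiable (at t)"
    by (rule smooth_on_imp_differentiable[of UNIV], rule smooth_on_compose_UNIV[OF smooth_coframe])
      (auto intro!: smooth_on_bounded_linear bounded_linear_scaleR_left)
  then have "J differentiable (at t)" unfolding J_def by (auto intro!: derivative_intros differentiable_scaleR)
  then obtain J' where J': "(J has_vector_derivative J') (at t)"
    using vector_derivative_works by blast
  \<comment> \<open>The factor \<open>t\<close> in \<open>J\<close> makes its image under the frame
    the plain vector \<open>t *\<^sub>R v\<close>, whose derivative is known; the Leibniz rule then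
    yields an equation for \<open>J'\<close>.\<close>
  have FJ: "frame (t *\<^sub>R u) (J t) = t *\<^sub>R v" for t
    unfolding J_def using linear_cmul[OF bounded_linear.linear[OF bounded_linear_frame]] by simp
  have "((\<lambda>t. t *\<^sub>R v) has_vector_derivative frame (t *\<^sub>R u) J' + dframe (t *\<^sub>R u) (J t) u) (at t)"
    using frame_along_curve[OF c J'] by (simp add: FJ)
  moreover have "((\<lambda>t. t *\<^sub>R v) has_vector_derivative v) (at t)"
    by (auto intro!: derivative_eq_intros)
  ultimately have 1: "frame (t *\<^sub>R u) J' + dframe (t *\<^sub>R u) (J t) u = v"
    by (rule vector_derivative_unique_at)
  \<comment> \<open>Linearity in both slots moves the factor \<open>t\<close> onto the frame vector,
    so that it coincides with the base point and \<open>dframe_self\<close> applies.\<close>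
  have "dframe (t *\<^sub>R u) u (t *\<^sub>R v) = dframe (t *\<^sub>R u) (t *\<^sub>R u) v"
    using linear_cmul[OF linear_dframe] linear_cmul[OF linear_dframe_left] by simp
  then have 2: "dframe (t *\<^sub>R u) u (t *\<^sub>R v) = v - frame (t *\<^sub>R u) v" by (simp add: dframe_self)
  have "frame (t *\<^sub>R u) (br u (J t)) = frame (t *\<^sub>R u) v - frame (t *\<^sub>R u) J'"
    unfolding frame_bracket FJ 2 using 1 by (simp add: algebra_simps)
  then have "coframe (t *\<^sub>R u) (frame (t *\<^sub>R u) (br u (J t))) = coframe (t *\<^sub>R u) (frame (t *\<^sub>R u) (v - J'))"
    using linear_diff[OF bounded_linear.linear[OF bounded_linear_frame]] by simp
  then have "J' = v - br u (J t)" by simp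
  with J' show ?thesis by (simp add: J_def[abs_def])
qed

text \<open>The curves \<open>D (J t)\<close> and \<open>K t\<close> solve the same linear equation:
  the first is the image of a solution under \<open>D\<close>, which respects the bracket, the
  second is the solution for \<open>D u\<close> and \<open>D v\<close>. Both vanish at t = 0, hence
  they agree at t = 1, so \<open>D\<close> intertwines the coframes and therefore their
  inverses.\<close>

lemma frame_morphism:
  assumes "bounded_linear D" "\<And>u v. D (br u v) = br (D u) (D v)"
  shows "frame (D x) (D w) = D (frame x w)"
proof -
  have key: "D (coframe u v) = coframe (D u) (D v)" for u v
  proof -
    have sc: "D (t *\<^sub>R y) = t *\<^sub>R D y" for t y
      by (rule linear_cmul[OF bounded_linear.linear[OF assms(1)]])
    have df: "D (y - z) = D y - D z" for y z
      by (rule linear_diff[OF bounded_linear.linear[OF assms(1)]])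
    define J where "J t = t *\<^sub>R coframe (t *\<^sub>R u) v" for t
    define K where "K t = t *\<^sub>R coframe (t *\<^sub>R D u) (D v)" for t
    define F where "F = (\<lambda>y. - br (D u) y)"
    have J: "((\<lambda>t. D (J t)) has_vector_derivative D (v - br u (J t))) (at t)" for t
      using bounded_linear.has_vector_derivative[OF assms(1) coframe_ode] by (simp add: J_def)
    have K: "(K has_vector_derivative D v - br (D u) (K t)) (at t)" for t
      using coframe_ode by (simp add: K_def[abs_def])
    have "(\<lambda>t. D (J t) - K t) 1 = 0"
    proof (rule linear_ode_zero[where F=F])
      show "bounded_linear F" unfolding F_def by (intro bounded_linear_minus bounded_linear_bracket)
      show "D (J 0) - K 0 = 0" using sc[of 0] by (simp add: J_def K_def)
      show "((\<lambda>t. D (J t) - K t) has_vector_derivative F (D (J t) - K t)) (at t)" for t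
        using has_vector_derivative_diff[OF J K, of t]
          linear_diff[OF bounded_linear.linear[OF bounded_linear_bracket]]
        by (simp add: df assms(2) F_def)
    qed simp
    then show ?thesis by (simp add: J_def K_def)
  qed
  have "frame (D x) (D (coframe x (frame x w))) = D (frame x w)" unfolding key by simp
  then show ?thesis by simp
qed

end

section \<open>Homogeneous groups in exponential coordinates\<close>

text \<open>On an eigenvector the exponential series is a scalar series with sum
  \<open>r powr c b\<close>. Continuity, the flow equation and the contraction to the unit are read
  off from this closed formula.\<close>

lemma eigenbasis_dilation:
  fixes A :: "'a::euclidean_space \<Rightarrow> 'a"
  assumes "linear A" "independent B" "span B = UNIV" "\<And>b. b \<in> B \<Longrightarrow> A b = c b *\<^sub>R b" "r > 0"
  shows "algebra_dilation A r v = (\<Sum>b\<in>B. (representation B v b * r powr c b) *\<^sub>R b)"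
proof -
  have fin: "finite B" using independent_imp_finite[OF assms(2)] .
  have v: "v = (\<Sum>b\<in>B. representation B v b *\<^sub>R b)"
    using real_vector.sum_representation_eq[OF assms(2) _ fin subset_refl, of v] assms(3) by simp
  have pow: "(A ^^ k) v = (\<Sum>b\<in>B. (representation B v b * c b ^ k) *\<^sub>R b)" for k
  proof (induction k)
    case 0 then show ?case using v by simp
  next
    case (Suc k) then show ?case
      by (simp add: linear_sum[OF assms(1)] linear_cmul[OF assms(1)] assms(4) mult_ac)
  qed
  have "(\<lambda>k. \<Sum>b\<in>B. ((ln r * c b) ^ k /\<^sub>R fact k) *\<^sub>R (representation B v b *\<^sub>R b))
      sums (\<Sum>b\<in>B. exp (ln r * c b) *\<^sub>R (representation B v b *\<^sub>R b))"
    by (intro sums_sum sums_scaleR_left exp_converges)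
  moreover have "(\<Sum>b\<in>B. ((ln r * c b) ^ k /\<^sub>R fact k) *\<^sub>R (representation B v b *\<^sub>R b))
      = (ln r ^ k / fact k) *\<^sub>R (A ^^ k) v" for k
    by (simp add: pow scaleR_sum_right power_mult_distrib field_simps)
  ultimately have "algebra_dilation A r v = (\<Sum>b\<in>B. exp (ln r * c b) *\<^sub>R (representation B v b *\<^sub>R b))"
    unfolding algebra_dilation_def by (simp add: sums_iff)
  then show ?thesis using assms(5) by (simp add: powr_def mult_ac)
qed

locale homogeneous_lie_group =
  fixes \<A> :: "('g::{topological_group_add,t2_space,second_countable_topology}, 'a::euclidean_space) chart set"
    and L :: "'a \<Rightarrow> 'g vfield" and e :: "'a \<Rightarrow> 'g" and A :: "'a \<Rightarrow> 'a"
  assumes homogeneous: "homogeneous_group \<A> L e A"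
begin

lemma atlas: "smooth_atlas \<A>"
  and diffeo: "diffeo_from_model \<A> e"
  and exponential: "exponential_map \<A> L e"
  and algebra_iso: "lie_algebra_iso \<A> L"
  using homogeneous by (auto simp: homogeneous_group_def lie_group_def)

lemma inv_e [simp]: "inv e (e v) = v" and e_inv [simp]: "e (inv e x) = x"
  and continuous_e: "continuous_on UNIV e" and continuous_inv_e: "continuous_on UNIV (inv e)"
  using diffeo by (auto simp: diffeo_from_model_def homeomorphism_def)

lemma chart:
  assumes "(U, \<phi>) \<in> \<A>"
  shows "open U" "open (\<phi> ` U)" "\<And>x. x \<in> U \<Longrightarrow> inv_into U \<phi> (\<phi> x) = x"
    "continuous_on (\<phi> ` U) (inv_into U \<phi>)"
    "smooth_on (\<phi> ` U) (\<lambda>a. inv e (inv_into U \<phi> a))"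
    "smooth_on (e -` U) (\<lambda>v. \<phi> (e v))"
  using assms atlas diffeo
  by (force simp: smooth_atlas_def diffeo_from_model_def smooth_fun_def homeomorphism_def)+

lemma ex_chart: obtains U \<phi> where "(U, \<phi>) \<in> \<A>" "x \<in> U"
proof -
  have "x \<in> (\<Union>(U, \<phi>)\<in>\<A>. U)" using atlas by (simp add: smooth_atlas_def)
  with that show ?thesis by auto
qed

text \<open>The exponential map is a diffeomorphism, so it serves as one global chart and the atlas
  can be left behind.\<close>

lemma smooth_fun_iff: "smooth_fun \<A> f \<longleftrightarrow> smooth_on UNIV (\<lambda>v. f (e v))"
proof
  assume f: "smooth_fun \<A> f"
  show "smooth_on UNIV (\<lambda>v. f (e v))"
  proof (rule smooth_on_local)
    fix v
    obtain U \<phi> where U: "(U, \<phi>) \<in> \<A>" "e v \<in> U" by (rule ex_chart)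
    have o: "open (e -` U)" using chart(1)[OF U(1)] continuous_e by (rule open_vimage)
    have "smooth_on (\<phi> ` U) (\<lambda>a. f (inv_into U \<phi> a))" using f U(1) by (auto simp: smooth_fun_def)
    then have "smooth_on (e -` U) (\<lambda>v. f (inv_into U \<phi> (\<phi> (e v))))"
      by (intro smooth_on_compose[OF o chart(2)[OF U(1)] _ _ chart(6)[OF U(1)]]) auto
    then have "smooth_on (e -` U) (\<lambda>v. f (e v))"
      by (subst smooth_on_cong[OF o, of _ "\<lambda>v. f (inv_into U \<phi> (\<phi> (e v)))"]) (auto simp: chart(3)[OF U(1)])
    then show "\<exists>T. open T \<and> v \<in> T \<and> smooth_on T (\<lambda>v. f (e v))" using o U(2) by auto
  qed
next
  assume f: "smooth_on UNIV (\<lambda>v. f (e v))"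
  have "smooth_on (\<phi> ` U) (\<lambda>a. f (inv_into U \<phi> a))" if U: "(U, \<phi>) \<in> \<A>" for U \<phi>
    using smooth_on_compose[OF chart(2)[OF U] open_UNIV _ f chart(5)[OF U]] by simp
  then show "smooth_fun \<A> f" by (auto simp: smooth_fun_def)
qed

text \<open>The group law read in the Lie algebra: log (exp u exp v), the Campbell-Hausdorff
  product.\<close>

definition law :: "'a \<Rightarrow> 'a \<Rightarrow> 'a" where
  "law u v = inv e (e u + e v)"

lemma e_law: "e (law u v) = e u + e v"
  by (simp add: law_def)

text \<open>Near a given pair the law factors through three charts: from exponential coordinates
  into \<open>U\<close> and \<open>V\<close>, the group law into \<open>W\<close>, and back to
  exponential coordinates. The sets \<open>S\<close> and \<open>T\<close> are the domains of the
  middle factor and of the whole composite.\<close>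

lemma smooth_law: "smooth_on UNIV (\<lambda>z. law (fst z) (snd z))"
proof (rule smooth_on_local)
  fix z :: "'a \<times> 'a"
  obtain U \<phi> where U: "(U, \<phi>) \<in> \<A>" "e (fst z) \<in> U" by (rule ex_chart)
  obtain V \<psi> where V: "(V, \<psi>) \<in> \<A>" "e (snd z) \<in> V" by (rule ex_chart)
  obtain W \<eta> where W: "(W, \<eta>) \<in> \<A>" "e (fst z) + e (snd z) \<in> W" by (rule ex_chart)
  define S where "S = {(a, b). a \<in> \<phi> ` U \<and> b \<in> \<psi> ` V \<and> inv_into U \<phi> a + inv_into V \<psi> b \<in> W}"
  define T where "T = {z. e (fst z) \<in> U \<and> e (snd z) \<in> V \<and> e (fst z) + e (snd z) \<in> W}"
  define mu where "mu = (\<lambda>(a, b). \<eta> (inv_into U \<phi> a + inv_into V \<psi> b))"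
  have mu: "smooth_on S mu"
    using homogeneous U(1) V(1) W(1) unfolding homogeneous_group_def lie_group_def S_def mu_def by blast
  have e1: "continuous_on UNIV (\<lambda>z. e (fst z))" "continuous_on UNIV (\<lambda>z. e (snd z))"
    by (auto intro!: continuous_on_compose2[OF continuous_e] continuous_intros)
  have "T = (\<lambda>z. e (fst z)) -` U \<inter> (\<lambda>z. e (snd z)) -` V \<inter> (\<lambda>z. e (fst z) + e (snd z)) -` W"
    by (auto simp: T_def)
  then have oT: "open T"
    by (auto intro!: open_Int open_vimage chart(1)[OF U(1)] chart(1)[OF V(1)] chart(1)[OF W(1)]
        e1 continuous_on_add)
  have oUV: "open (\<phi> ` U \<times> \<psi> ` V)" by (intro open_Times chart(2)[OF U(1)] chart(2)[OF V(1)])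
  have "continuous_on (\<phi> ` U \<times> \<psi> ` V) (\<lambda>z. inv_into U \<phi> (fst z) + inv_into V \<psi> (snd z))"
    by (intro continuous_on_add continuous_on_compose2[OF chart(4)[OF U(1)]]
        continuous_on_compose2[OF chart(4)[OF V(1)]] continuous_intros) auto
  then have "open ((\<lambda>z. inv_into U \<phi> (fst z) + inv_into V \<psi> (snd z)) -` W \<inter> (\<phi> ` U \<times> \<psi> ` V))"
    using chart(1)[OF W(1)] oUV continuous_on_open_vimage by blast
  moreover have "S = (\<lambda>z. inv_into U \<phi> (fst z) + inv_into V \<psi> (snd z)) -` W \<inter> (\<phi> ` U \<times> \<psi> ` V)"
    by (auto simp: S_def)
  ultimately have oS: "open S" by simp
  have p: "smooth_on T (\<lambda>z. \<phi> (e (fst z)))" "smooth_on T (\<lambda>z. \<psi> (e (snd z)))"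
    by (rule smooth_on_compose[OF oT open_vimage[OF chart(1)[OF U(1)] continuous_e] _ chart(6)[OF U(1)]];
        auto simp: T_def intro!: smooth_on_bounded_linear bounded_linear_fst)
       (rule smooth_on_compose[OF oT open_vimage[OF chart(1)[OF V(1)] continuous_e] _ chart(6)[OF V(1)]];
        auto simp: T_def intro!: smooth_on_bounded_linear bounded_linear_snd)
  have "smooth_on T (\<lambda>z. mu (\<phi> (e (fst z)), \<psi> (e (snd z))))"
    by (rule smooth_on_compose[OF oT oS _ mu smooth_on_Pair[OF oT p]])
      (auto simp: S_def T_def chart(3)[OF U(1)] chart(3)[OF V(1)])
  then have "smooth_on T (\<lambda>z. \<eta> (e (fst z) + e (snd z)))"
    by (subst smooth_on_cong[OF oT, of _ "\<lambda>z. mu (\<phi> (e (fst z)), \<psi> (e (snd z)))"])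
      (auto simp: T_def mu_def chart(3)[OF U(1)] chart(3)[OF V(1)])
  then have "smooth_on T (\<lambda>z. inv e (inv_into W \<eta> (\<eta> (e (fst z) + e (snd z)))))"
    by (intro smooth_on_compose[OF oT chart(2)[OF W(1)] _ chart(5)[OF W(1)]]) (auto simp: T_def)
  then have "smooth_on T (\<lambda>z. law (fst z) (snd z))"
    by (subst smooth_on_cong[OF oT, of _ "\<lambda>z. inv e (inv_into W \<eta> (\<eta> (e (fst z) + e (snd z))))"])
      (auto simp: T_def law_def chart(3)[OF W(1)])
  moreover have "z \<in> T" using U(2) V(2) W(2) by (simp add: T_def)
  ultimately show "\<exists>T. open T \<and> z \<in> T \<and> smooth_on T (\<lambda>z. law (fst z) (snd z))" using oT by blast
qed

sublocale exponential_law law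
proof
  show "smooth_on UNIV (\<lambda>z. law (fst z) (snd z))" by (rule smooth_law)
  show "law (law x y) z = law x (law y z)" for x y z by (simp add: law_def add.assoc)
  show "law (s *\<^sub>R x) (t *\<^sub>R x) = (s + t) *\<^sub>R x" for s t x
    using exponential unfolding exponential_map_def law_def by (metis inv_e)
qed

lemma e_zero [simp]: "e 0 = 0"
  using e_law[of 0 0] by (metis add.right_neutral add_left_cancel zero_left)

lemma smooth_fun_translate:
  assumes "smooth_fun \<A> f" shows "smooth_fun \<A> (\<lambda>x. f (y + x))"
proof -
  have "smooth_on UNIV (\<lambda>v. law (inv e y) v)"
    using smooth_on_compose_UNIV[OF smooth_law, of "Pair (inv e y)"]
    by (simp add: smooth_on_Pair smooth_on_const smooth_on_bounded_linear bounded_linear_ident)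
  from smooth_on_compose_UNIV[OF assms[unfolded smooth_fun_iff] this]
  show ?thesis by (simp add: smooth_fun_iff e_law)
qed

text \<open>\<open>exponential_map\<close> describes \<open>L w\<close> at the unit. Left-invariance
  moves the evaluation from \<open>e x\<close> to the unit at the price of translating
  \<open>f\<close>, and the chain rule through \<open>law x\<close> turns the resulting derivative
  into one along \<open>frame x w\<close>.\<close>

lemma L_frame:
  assumes "smooth_fun \<A> f"
  shows "L w f (e x) = frechet_derivative (\<lambda>v. f (e v)) (at x) (frame x w)"
proof -
  have "L w \<in> left_invariant_fields \<A>" using algebra_iso by (auto simp: lie_algebra_iso_def bij_betw_def)
  then have inv: "L w (\<lambda>y. f (e x + y)) = (\<lambda>y. L w f (e x + y))"
    using assms by (auto simp: left_invariant_fields_def)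
  have "((\<lambda>t. f (e x + e (t *\<^sub>R w))) has_real_derivative L w (\<lambda>y. f (e x + y)) 0) (at 0)"
    using exponential smooth_fun_translate[OF assms] unfolding exponential_map_def by blast
  then have 1: "((\<lambda>t. f (e (law x (t *\<^sub>R w)))) has_real_derivative L w f (e x)) (at 0)"
    by (simp add: inv e_law)
  have "((\<lambda>t. t *\<^sub>R w) has_derivative (\<lambda>t. t *\<^sub>R w)) (at (0::real))"
    by (auto intro!: derivative_eq_intros)
  moreover have "(law x has_derivative frame x) (at (0 *\<^sub>R w))"
    using has_derivative_translation[of x 0] by (simp add: frame_def)
  ultimately have "((\<lambda>t. law x (t *\<^sub>R w)) has_derivative (\<lambda>t. frame x (t *\<^sub>R w))) (at 0)"
    by (rule has_derivative_compose)
  moreover have "((\<lambda>v. f (e v)) has_derivative frechet_derivative (\<lambda>v. f (e v)) (at x)) (at (law x (0 *\<^sub>R w)))"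
    using smooth_on_imp_has_derivative[OF assms[unfolded smooth_fun_iff]] by simp
  ultimately have "((\<lambda>t. f (e (law x (t *\<^sub>R w)))) has_derivative
      (\<lambda>t. frechet_derivative (\<lambda>v. f (e v)) (at x) (frame x (t *\<^sub>R w)))) (at 0)"
    by (rule has_derivative_compose)
  from has_derivative_unique[OF this 1[unfolded has_field_derivative_def]]
  show ?thesis by (auto dest: fun_cong[of _ _ 1])
qed

lemma smooth_fun_add: "smooth_fun \<A> f \<Longrightarrow> smooth_fun \<A> g \<Longrightarrow> smooth_fun \<A> (\<lambda>x. f x + g x)"
  by (simp add: smooth_fun_iff smooth_on_add)

lemma smooth_fun_mult:
  fixes f g :: "'g \<Rightarrow> real"
  shows "smooth_fun \<A> f \<Longrightarrow> smooth_fun \<A> g \<Longrightarrow> smooth_fun \<A> (\<lambda>x. f x * g x)"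
  by (simp add: smooth_fun_iff smooth_on_bilinear[OF bounded_bilinear_mult])

lemma smooth_fun_const: "smooth_fun \<A> (\<lambda>x. c)"
  by (simp add: smooth_fun_iff smooth_on_const)

lemma smooth_fun_diff:
  fixes f g :: "'g \<Rightarrow> real"
  assumes "smooth_fun \<A> f" "smooth_fun \<A> g" shows "smooth_fun \<A> (\<lambda>x. f x - g x)"
  using smooth_fun_add[OF assms(1) smooth_fun_mult[OF smooth_fun_const assms(2), of "-1"]] by simp

text \<open>A product of two derivations violates the Leibniz rule by
  \<open>Y f x * X g x + X f x * Y g x\<close>, which is symmetric in \<open>X\<close> and
  \<open>Y\<close> and cancels in the commutator.\<close>

lemma commutator_left_invariant:
  assumes X: "X \<in> left_invariant_fields \<A>" and Y: "Y \<in> left_invariant_fields \<A>"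
  shows "(\<lambda>f x. X (Y f) x - Y (X f) x) \<in> left_invariant_fields \<A>"
proof -
  have ns: "\<And>X f. X \<in> left_invariant_fields \<A> \<Longrightarrow> \<not> smooth_fun \<A> f \<Longrightarrow> X f = (\<lambda>x. 0)"
    and sm: "\<And>X f. X \<in> left_invariant_fields \<A> \<Longrightarrow> smooth_fun \<A> f \<Longrightarrow> smooth_fun \<A> (X f)"
    and ad: "\<And>X f g. X \<in> left_invariant_fields \<A> \<Longrightarrow> smooth_fun \<A> f \<Longrightarrow> smooth_fun \<A> g
      \<Longrightarrow> X (\<lambda>x. f x + g x) = (\<lambda>x. X f x + X g x)"
    and sc: "\<And>X f c. X \<in> left_invariant_fields \<A> \<Longrightarrow> smooth_fun \<A> f
      \<Longrightarrow> X (\<lambda>x. c * f x) = (\<lambda>x. c * X f x)"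
    and mu: "\<And>X f g. X \<in> left_invariant_fields \<A> \<Longrightarrow> smooth_fun \<A> f \<Longrightarrow> smooth_fun \<A> g
      \<Longrightarrow> X (\<lambda>x. f x * g x) = (\<lambda>x. X f x * g x + f x * X g x)"
    and li: "\<And>X f y. X \<in> left_invariant_fields \<A> \<Longrightarrow> smooth_fun \<A> f
      \<Longrightarrow> X (\<lambda>x. f (y + x)) = (\<lambda>x. X f (y + x))"
    by (auto simp: left_invariant_fields_def)
  have z: "X (\<lambda>x. 0) = (\<lambda>x. 0)" if "X \<in> left_invariant_fields \<A>" for X
    using sc[OF that smooth_fun_const, of 0 0] by simp
  have *: "X (Y (\<lambda>x. f x * g x)) = (\<lambda>x. (X (Y f) x * g x + Y f x * X g x) + (X f x * Y g x + f x * X (Y g) x))"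
    if "X \<in> left_invariant_fields \<A>" "Y \<in> left_invariant_fields \<A>" "smooth_fun \<A> f" "smooth_fun \<A> g" for X Y f g
  proof -
    have "X (Y (\<lambda>x. f x * g x)) = X (\<lambda>x. Y f x * g x + f x * Y g x)"
      by (simp only: mu[OF that(2,3,4)])
    also have "\<dots> = (\<lambda>x. X (\<lambda>x. Y f x * g x) x + X (\<lambda>x. f x * Y g x) x)"
      by (rule ad[OF that(1) smooth_fun_mult[OF sm[OF that(2,3)] that(4)] smooth_fun_mult[OF that(3) sm[OF that(2,4)]]])
    also have "X (\<lambda>x. Y f x * g x) = (\<lambda>x. X (Y f) x * g x + Y f x * X g x)"
      by (rule mu[OF that(1) sm[OF that(2,3)] that(4)])
    also have "X (\<lambda>x. f x * Y g x) = (\<lambda>x. X f x * Y g x + f x * X (Y g) x)"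
      by (rule mu[OF that(1,3) sm[OF that(2,4)]])
    finally show ?thesis .
  qed
  have li': "X (Y (\<lambda>x. f (y + x))) = (\<lambda>x. X (Y f) (y + x))"
    if "X \<in> left_invariant_fields \<A>" "Y \<in> left_invariant_fields \<A>" "smooth_fun \<A> f" for X Y f y
    by (simp only: li[OF that(2,3)] li[OF that(1) sm[OF that(2,3)]])
  have ad': "X (Y (\<lambda>x. f x + g x)) = (\<lambda>x. X (Y f) x + X (Y g) x)"
    if "X \<in> left_invariant_fields \<A>" "Y \<in> left_invariant_fields \<A>" "smooth_fun \<A> f" "smooth_fun \<A> g" for X Y f g
    by (simp only: ad[OF that(2,3,4)] ad[OF that(1) sm[OF that(2,3)] sm[OF that(2,4)]])
  have sc': "X (Y (\<lambda>x. c * f x)) = (\<lambda>x. c * X (Y f) x)"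
    if "X \<in> left_invariant_fields \<A>" "Y \<in> left_invariant_fields \<A>" "smooth_fun \<A> f" for X Y f c
    by (simp only: sc[OF that(2,3)] sc[OF that(1) sm[OF that(2,3)]])
  show ?thesis
    unfolding left_invariant_fields_def mem_Collect_eq
  proof (intro conjI allI impI)
    fix f :: "'g \<Rightarrow> real" assume "\<not> smooth_fun \<A> f"
    then show "(\<lambda>x. X (Y f) x - Y (X f) x) = (\<lambda>x. 0)" by (simp add: ns[OF X] ns[OF Y] z[OF X] z[OF Y])
  next
    fix f :: "'g \<Rightarrow> real" assume "smooth_fun \<A> f"
    then show "smooth_fun \<A> (\<lambda>x. X (Y f) x - Y (X f) x)" by (intro smooth_fun_diff sm[OF X] sm[OF Y])
  next
    fix f g :: "'g \<Rightarrow> real" assume fg: "smooth_fun \<A> f" "smooth_fun \<A> g"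
    show "(\<lambda>x. X (Y (\<lambda>x. f x + g x)) x - Y (X (\<lambda>x. f x + g x)) x) =
      (\<lambda>x. X (Y f) x - Y (X f) x + (X (Y g) x - Y (X g) x))"
      by (simp only: ad'[OF X Y fg] ad'[OF Y X fg]) (simp add: fun_eq_iff)
    show "(\<lambda>x. X (Y (\<lambda>x. f x * g x)) x - Y (X (\<lambda>x. f x * g x)) x) =
      (\<lambda>x. (X (Y f) x - Y (X f) x) * g x + f x * (X (Y g) x - Y (X g) x))"
      by (simp only: *[OF X Y fg] *[OF Y X fg]) (simp add: fun_eq_iff algebra_simps)
  next
    fix f :: "'g \<Rightarrow> real" and c assume f: "smooth_fun \<A> f"
    show "(\<lambda>x. X (Y (\<lambda>x. c * f x)) x - Y (X (\<lambda>x. c * f x)) x) = (\<lambda>x. c * (X (Y f) x - Y (X f) x))"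
      by (simp only: sc'[OF X Y f] sc'[OF Y X f]) (simp add: fun_eq_iff algebra_simps)
  next
    fix f :: "'g \<Rightarrow> real" and y assume f: "smooth_fun \<A> f"
    show "(\<lambda>x. X (Y (\<lambda>x. f (y + x))) x - Y (X (\<lambda>x. f (y + x))) x) = (\<lambda>x. X (Y f) (y + x) - Y (X f) (y + x))"
      by (simp only: li'[OF X Y f] li'[OF Y X f])
  qed
qed

text \<open>The description in \<open>lie_bracket\<close> denotes: \<open>L\<close> is onto the
  left-invariant fields, among which the commutator lies, and it is injective.\<close>

lemma bracket_apply:
  "L (lie_bracket L u v) f x = L u (L v f) x - L v (L u f) x"
proof -
  have bij: "bij_betw L UNIV (left_invariant_fields \<A>)" using algebra_iso by (simp add: lie_algebra_iso_def)
  have "(\<lambda>f x. L u (L v f) x - L v (L u f) x) \<in> left_invariant_fields \<A>"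
    by (intro commutator_left_invariant bij_betwE[OF bij, rule_format]) auto
  then obtain w where w: "L w = (\<lambda>f x. L u (L v f) x - L v (L u f) x)"
    using bij by (metis (no_types, lifting) bij_betw_iff_bijections)
  have "w' = w" if "\<forall>f x. L w' f x = L u (L v f) x - L v (L u f) x" for w'
  proof -
    have "L w' = L w" using that w by (simp add: fun_eq_iff)
    then show ?thesis using bij by (auto simp: bij_betw_def dest: injD)
  qed
  then have "\<exists>!w. \<forall>f x. L w f x = L u (L v f) x - L v (L u f) x"
    by (intro ex1I[of _ w]) (auto simp: w)
  from theI'[OF this] show ?thesis unfolding lie_bracket_def by blast
qed

sublocale exponential_law_bracket law "lie_bracket L"
proof
  fix x u v
  have "frame x (lie_bracket L u v) \<bullet> b = (dframe x v (frame x u) - dframe x u (frame x v)) \<bullet> b" for b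
  proof -
    \<comment> \<open>Tested on a coordinate function, \<open>L w\<close> gives a coordinate of
      \<open>frame\<close>, and applying a second field gives the same coordinate of
      \<open>dframe\<close>.\<close>
    define f where "f = (\<lambda>y. inv e y \<bullet> b)"
    have f: "smooth_fun \<A> f"
      by (auto simp: smooth_fun_iff f_def intro!: smooth_on_bounded_linear bounded_linear_inner_left)
    have fd: "frechet_derivative (\<lambda>v. f (e v)) (at x) w = w \<bullet> b" for x w
      by (simp add: f_def frechet_derivative_at[OF bounded_linear_imp_has_derivative, OF bounded_linear_inner_left, symmetric])
    have Lf: "L w f (e y) = frame y w \<bullet> b" for w y
      by (simp add: L_frame[OF f] fd)
    have sLf: "smooth_fun \<A> (L w f)" for w
    proof -
      have "L w \<in> left_invariant_fields \<A>" using algebra_iso by (auto simp: lie_algebra_iso_def bij_betw_def)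
      then show ?thesis using f by (auto simp: left_invariant_fields_def)
    qed
    have LL: "L u (L v f) (e x) = dframe x v (frame x u) \<bullet> b" for u v
    proof -
      have "((\<lambda>y. frame y v \<bullet> b) has_derivative (\<lambda>u. dframe x v u \<bullet> b)) (at x)"
        by (intro has_derivative_inner_left has_derivative_frame)
      from frechet_derivative_at[OF this] show ?thesis
        unfolding L_frame[OF sLf] Lf by metis
    qed
    show ?thesis using bracket_apply[of u v f "e x"] by (simp add: Lf LL inner_diff_left)
  qed
  then show "frame x (lie_bracket L u v) = dframe x v (frame x u) - dframe x u (frame x v)"
    by (rule euclidean_eqI)
qed

abbreviation D :: "real \<Rightarrow> 'a \<Rightarrow> 'a" where "D \<equiv> algebra_dilation A"

lemma frame_dilation:
  assumes "r > 0" shows "frame (D r x) (D r w) = D r (frame x w)"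
  using homogeneous assms
  by (intro frame_morphism) (auto simp: homogeneous_group_def lie_algebra_morphism_def linear_conv_bounded_linear)

end

section \<open>Change of variables on a Euclidean space\<close>

text \<open>The library proves the change of variables formula only for \<open>real ^ 'n\<close>. The basis of a
  Euclidean space, turned into a type, provides such an index type of the right cardinality.\<close>

typedef (overloaded) ('a::euclidean_space) basis_index = "Basis :: 'a set"
  by (metis ex_in_conv nonempty_Basis)

instance basis_index :: (euclidean_space) finite
proof
  have "inj_on Rep_basis_index (UNIV :: 'a basis_index set)" by (simp add: inj_on_def Rep_basis_index_inject)
  moreover have "finite (range (Rep_basis_index :: 'a basis_index \<Rightarrow> 'a))"
    by (rule finite_subset[OF _ finite_Basis]) (use Rep_basis_index in auto)
  ultimately show "finite (UNIV :: 'a basis_index set)" by (rule finite_imageD[rotated])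
qed

instantiation basis_index :: (euclidean_space) wellorder
begin

text \<open>Any injection into the naturals serves. It provides the well-order that the theorem on
  measures of differentiable images demands of the index type.\<close>

definition basis_index_rank :: "'a basis_index \<Rightarrow> nat" where
  "basis_index_rank = (SOME g. inj g)"

definition less_eq_basis_index :: "'a basis_index \<Rightarrow> 'a basis_index \<Rightarrow> bool" where
  "x \<le> y \<longleftrightarrow> basis_index_rank x \<le> basis_index_rank y"

definition less_basis_index :: "'a basis_index \<Rightarrow> 'a basis_index \<Rightarrow> bool" where
  "x < y \<longleftrightarrow> basis_index_rank x < basis_index_rank y"

instance
proof
  have "\<exists>g :: 'a basis_index \<Rightarrow> nat. inj g"
    using finite_imp_inj_to_nat_seg[OF finite_class.finite_UNIV] by blast
  then have inj: "inj (basis_index_rank :: 'a basis_index \<Rightarrow> nat)"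
    unfolding basis_index_rank_def by (rule someI_ex)
  fix x y z :: "'a basis_index"
  show "x < y \<longleftrightarrow> x \<le> y \<and> \<not> y \<le> x" "x \<le> x" "x \<le> y \<Longrightarrow> y \<le> z \<Longrightarrow> x \<le> z" "x \<le> y \<or> y \<le> x"
    by (auto simp: less_eq_basis_index_def less_basis_index_def)
  show "x \<le> y \<Longrightarrow> y \<le> x \<Longrightarrow> x = y"
    using inj by (auto simp: less_eq_basis_index_def dest: injD)
  fix P :: "'a basis_index \<Rightarrow> bool" and a
  assume P: "\<And>x. (\<And>y. y < x \<Longrightarrow> P y) \<Longrightarrow> P x"
  show "P a"
    by (induction a rule: measure_induct_rule[where f=basis_index_rank])
      (auto intro: P simp: less_basis_index_def)
qed

end

abbreviation bvec :: "'a::euclidean_space basis_index \<Rightarrow> 'a" where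
  "bvec \<equiv> Rep_basis_index"

lemma bvec_in_Basis [simp]: "bvec i \<in> Basis" by (rule Rep_basis_index)

lemma bij_bvec: "bij_betw bvec UNIV Basis"
  unfolding bij_betw_def using Rep_basis_index_inject type_definition.Rep_range[OF type_definition_basis_index]
  by (auto simp: inj_on_def)

lemma inner_bvec: "bvec i \<bullet> bvec j = (if i = j then 1 else 0)"
  by (simp add: inner_Basis Rep_basis_index_inject)

lemma sum_Basis_bvec: "(\<Sum>b\<in>Basis. f b) = (\<Sum>i\<in>UNIV. f (bvec i))"
  by (rule sum.reindex_bij_betw[OF bij_bvec, symmetric])

lemma prod_Basis_bvec: "(\<Prod>b\<in>Basis. f b) = (\<Prod>i\<in>UNIV. f (bvec i))"
  by (rule prod.reindex_bij_betw[OF bij_bvec, symmetric])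

section \<open>Coordinates, matrices and Jacobians\<close>

definition to_vec :: "'a::euclidean_space \<Rightarrow> real ^ 'a basis_index" where
  "to_vec x = (\<chi> i. x \<bullet> bvec i)"

definition of_vec :: "real ^ 'a basis_index \<Rightarrow> 'a::euclidean_space" where
  "of_vec y = (\<Sum>i\<in>UNIV. (y $ i) *\<^sub>R bvec i)"

lemma of_vec_inner_bvec [simp]: "of_vec y \<bullet> bvec i = y $ i"
  by (simp add: of_vec_def inner_sum_left inner_bvec if_distrib cong: if_cong)

lemma to_of_vec [simp]: "to_vec (of_vec y) = y"
  by (simp add: to_vec_def)

lemma of_to_vec [simp]: "of_vec (to_vec x) = x"
  by (simp add: to_vec_def of_vec_def sum_Basis_bvec[of "\<lambda>b. (x \<bullet> b) *\<^sub>R b", symmetric] euclidean_representation)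

lemma bounded_linear_to_vec: "bounded_linear to_vec"
  by (rule linear_conv_bounded_linear[THEN iffD1], rule linearI)
    (simp_all add: to_vec_def vec_eq_iff inner_add_left)

lemma bounded_linear_of_vec: "bounded_linear of_vec"
  by (rule linear_conv_bounded_linear[THEN iffD1], rule linearI)
    (simp_all add: of_vec_def scaleR_left_distrib sum.distrib scaleR_sum_right)

lemma borel_to_vec [measurable]: "to_vec \<in> borel_measurable borel"
  and borel_of_vec [measurable]: "of_vec \<in> borel_measurable borel"
  by (intro borel_measurable_continuous_onI linear_continuous_on bounded_linear_to_vec bounded_linear_of_vec)+

text \<open>Lebesgue measure is determined by its values on boxes, and turning an orthonormal basis
  into coordinate axes carries boxes to boxes with the same side lengths.\<close>

lemma distr_lborel_to_vec: "distr lborel borel to_vec = lborel"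
proof (rule lborel_eqI[symmetric])
  fix l u :: "real ^ 'a basis_index" assume le: "\<And>b. b \<in> Basis \<Longrightarrow> l \<bullet> b \<le> u \<bullet> b"
  have le': "l $ i \<le> u $ i" for i
    using le[of "axis i 1"] by (simp add: inner_axis)
  have "to_vec -` box l u = box (of_vec l) (of_vec u)"
  proof -
    have "(\<forall>b\<in>Basis. P b) \<longleftrightarrow> (\<forall>i. P (bvec i))" for P :: "'a \<Rightarrow> bool"
      using bij_bvec unfolding bij_betw_def by (metis (no_types, lifting) bvec_in_Basis image_iff)
    then show ?thesis by (auto simp: box_def to_vec_def Basis_vec_def inner_axis)
  qed
  moreover have "emeasure lborel (box (of_vec l) (of_vec u)) = (\<Prod>b\<in>Basis. (of_vec u - of_vec l) \<bullet> b)"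
  proof (rule emeasure_lborel_box)
    fix b :: 'a assume "b \<in> Basis"
    then obtain i where "b = bvec i" using bij_bvec unfolding bij_betw_def by blast
    then show "of_vec l \<bullet> b \<le> of_vec u \<bullet> b" using le' by simp
  qed
  moreover have "(\<Prod>b\<in>Basis. (of_vec u - of_vec l) \<bullet> b) = (\<Prod>b\<in>Basis. (u - l) \<bullet> b)"
    by (simp add: prod_Basis_bvec inner_diff_left Basis_vec_def UNION_singleton_eq_range prod.reindex
        axis_eq_axis inj_on_def inner_axis)
  ultimately show "emeasure (distr lborel borel to_vec) (box l u) = (\<Prod>b\<in>Basis. (u - l) \<bullet> b)"
    by (simp add: emeasure_distr)
qed simp

definition eucl_matrix :: "('a::euclidean_space \<Rightarrow> 'a) \<Rightarrow> real ^ 'a basis_index ^ 'a basis_index" where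
  "eucl_matrix F = (\<chi> i j. F (bvec j) \<bullet> bvec i)"

lemma eucl_matrix_mult:
  assumes "linear F" shows "eucl_matrix (\<lambda>x. F (G x)) = eucl_matrix F ** eucl_matrix G"
proof -
  have "F (G x) \<bullet> y = (\<Sum>k\<in>UNIV. (F (bvec k) \<bullet> y) * (G x \<bullet> bvec k))" for x y
  proof -
    have "F (G x) = F (\<Sum>b\<in>Basis. (G x \<bullet> b) *\<^sub>R b)" by (simp add: euclidean_representation)
    also have "\<dots> = (\<Sum>k\<in>UNIV. (G x \<bullet> bvec k) *\<^sub>R F (bvec k))"
      by (simp add: linear_sum[OF assms] linear_cmul[OF assms] sum_Basis_bvec)
    finally show ?thesis by (simp add: inner_sum_left mult.commute)
  qed
  then show ?thesis by (simp add: eucl_matrix_def matrix_matrix_mult_def vec_eq_iff)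
qed

lemma eucl_matrix_ident: "eucl_matrix (\<lambda>x. x) = mat 1"
  by (simp add: eucl_matrix_def mat_def vec_eq_iff inner_bvec)

lemma operator_trace_eucl_matrix: "operator_trace F = trace (eucl_matrix F)"
  by (simp add: operator_trace_def trace_def eucl_matrix_def sum_Basis_bvec)

text \<open>Conjugation by the change of basis \<open>F\<close> makes \<open>G\<close> diagonal:
  \<open>G F = F \<Lambda>\<close>. The determinant of \<open>F\<close> cancels, and the trace is
  cyclic; hence \<open>operator_trace\<close>, although written with \<open>Basis\<close>, is the
  sum of the eigenvalues.\<close>

lemma eigenbasis_det_trace:
  fixes B :: "'a::euclidean_space set"
  assumes "independent B" "span B = UNIV" "linear G" "\<And>b. b \<in> B \<Longrightarrow> G b = g b *\<^sub>R b"
  shows "det (eucl_matrix G) = (\<Prod>b\<in>B. g b)" "operator_trace G = (\<Sum>b\<in>B. g b)"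
proof -
  have fin: "finite B" using independent_imp_finite[OF assms(1)] .
  have "card B = DIM('a)"
    using dim_eq_card[of B "UNIV :: 'a set"] assms(1,2) by simp
  moreover have "card (Basis :: 'a set) = CARD('a basis_index)" by (rule bij_betw_same_card[OF bij_bvec, symmetric])
  ultimately obtain \<beta> :: "'a basis_index \<Rightarrow> 'a" where \<beta>: "bij_betw \<beta> UNIV B"
    using fin by (metis finite finite_same_card_bij)
  have \<beta>B: "\<beta> j \<in> B" for j using \<beta> by (auto simp: bij_betw_def)
  \<comment> \<open>\<open>F\<close> sends the standard basis to the eigenbasis, and
    \<open>F'\<close> reads off coordinates in the eigenbasis, so the two are inverse to each
    other.\<close>
  define F where "F x = (\<Sum>j\<in>UNIV. (x \<bullet> bvec j) *\<^sub>R \<beta> j)" for x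
  define F' where "F' y = (\<Sum>j\<in>UNIV. representation B y (\<beta> j) *\<^sub>R bvec j)" for y
  have lF: "linear F"
    by (rule linearI) (simp_all add: F_def inner_add_left scaleR_left_distrib sum.distrib scaleR_sum_right)
  have Fb: "F (bvec j) = \<beta> j" for j
    by (simp add: F_def inner_bvec if_distrib[of "\<lambda>c. c *\<^sub>R _"] cong: if_cong)
  have "F (F' y) = y" for y
  proof -
    have "F (F' y) = (\<Sum>j\<in>UNIV. representation B y (\<beta> j) *\<^sub>R \<beta> j)"
      by (simp add: F'_def linear_sum[OF lF] linear_cmul[OF lF] Fb)
    also have "\<dots> = (\<Sum>b\<in>B. representation B y b *\<^sub>R b)"
      by (rule sum.reindex_bij_betw[OF \<beta>])
    also have "\<dots> = y"
      using real_vector.sum_representation_eq[OF assms(1) _ fin subset_refl, of y] assms(2) by simp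
    finally show ?thesis .
  qed
  then have SS: "eucl_matrix F ** eucl_matrix F' = mat 1"
    by (simp flip: eucl_matrix_mult[OF lF] add: eucl_matrix_ident)
  define \<Lambda> :: "real ^ 'a basis_index ^ 'a basis_index" where "\<Lambda> = (\<chi> i j. if i = j then g (\<beta> j) else 0)"
  have GS: "eucl_matrix G ** eucl_matrix F = eucl_matrix F ** \<Lambda>"
    unfolding eucl_matrix_mult[OF assms(3), symmetric]
    by (simp add: eucl_matrix_def \<Lambda>_def matrix_matrix_mult_def vec_eq_iff Fb assms(4)[OF \<beta>B]
        if_distrib mult.commute cong: if_cong)
  have dS: "det (eucl_matrix F) \<noteq> 0"
    using arg_cong[OF SS, of det] by (auto simp: det_mul)
  have "det (eucl_matrix G) * det (eucl_matrix F) = det (eucl_matrix F) * det \<Lambda>"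
    using arg_cong[OF GS, of det] by (simp add: det_mul)
  then have "det (eucl_matrix G) = det \<Lambda>" using dS by simp
  also have "\<dots> = (\<Prod>j\<in>UNIV. g (\<beta> j))"
    by (subst det_diagonal) (auto simp: \<Lambda>_def)
  also have "\<dots> = (\<Prod>b\<in>B. g b)" by (rule prod.reindex_bij_betw[OF \<beta>])
  finally show "det (eucl_matrix G) = (\<Prod>b\<in>B. g b)" .
  have "eucl_matrix G = eucl_matrix G ** (eucl_matrix F ** eucl_matrix F')" by (simp add: SS)
  also have "\<dots> = (eucl_matrix F ** \<Lambda>) ** eucl_matrix F'" by (simp only: matrix_mul_assoc GS)
  finally have "trace (eucl_matrix G) = trace (eucl_matrix F' ** (eucl_matrix F ** \<Lambda>))"
    by (simp only: trace_mul_sym[of "eucl_matrix F ** \<Lambda>"])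
  also have "eucl_matrix F' ** (eucl_matrix F ** \<Lambda>) = \<Lambda>"
    using SS by (simp add: matrix_mul_assoc matrix_left_right_inverse)
  also have "trace \<Lambda> = (\<Sum>j\<in>UNIV. g (\<beta> j))" by (simp add: trace_def \<Lambda>_def)
  also have "\<dots> = (\<Sum>b\<in>B. g b)" by (rule sum.reindex_bij_betw[OF \<beta>])
  finally show "operator_trace G = (\<Sum>b\<in>B. g b)" by (simp add: operator_trace_eucl_matrix)
qed

text \<open>A constant Jacobian makes this an identity between measures: Lebesgue measure is 1 / c
  times its image under the inverse map \<open>K\<close>. It suffices to compare the two on boxes,
  where the theorem on measures of differentiable images applies.\<close>

lemma nn_integral_const_Jacobian:
  fixes h :: "'a::euclidean_space \<Rightarrow> 'a"
  assumes der: "\<And>x. (h has_derivative h' x) (at x)"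
    and det: "\<And>x. \<bar>det (eucl_matrix (h' x))\<bar> = c" and "c > 0"
    and k: "\<And>x. h (k x) = x" "\<And>x. k (h x) = x" "continuous_on UNIV k"
    and F: "F \<in> borel_measurable borel"
  shows "(\<integral>\<^sup>+x. F x \<partial>lborel) = ennreal c * (\<integral>\<^sup>+x. F (h x) \<partial>lborel)"
proof -
  define H where "H y = to_vec (h (of_vec y))" for y
  define K where "K y = to_vec (k (of_vec y))" for y
  define H' where "H' y z = to_vec (h' (of_vec y) (of_vec z))" for y z
  have KH: "K (H y) = y" "H (K y) = y" for y by (simp_all add: H_def K_def k)
  have H': "(H has_derivative H' y) (at y)" for y
    unfolding H_def[abs_def] H'_def[abs_def]
    by (intro bounded_linear.has_derivative[OF bounded_linear_to_vec] has_derivative_compose[OF _ der]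
        bounded_linear_imp_has_derivative bounded_linear_of_vec)
  have m: "matrix (H' y) = eucl_matrix (h' (of_vec y))" for y
  proof -
    have "of_vec (axis j 1) = bvec j" for j :: "'a basis_index"
      by (simp add: of_vec_def axis_def if_distrib[of "\<lambda>c. c *\<^sub>R _"] cong: if_cong)
    then show ?thesis by (simp add: matrix_def eucl_matrix_def H'_def to_vec_def vec_eq_iff)
  qed
  have Kc: "continuous_on UNIV K" unfolding K_def
    by (intro continuous_on_compose2[OF linear_continuous_on[OF bounded_linear_to_vec]]
      continuous_on_compose2[OF k(3)] linear_continuous_on bounded_linear_of_vec) auto
  have [measurable]: "K \<in> borel_measurable borel" "k \<in> borel_measurable borel" "h \<in> borel_measurable borel"
    using Kc k(3) has_derivative_continuous[OF der]
    by (auto intro!: borel_measurable_continuous_onI continuous_at_imp_continuous_on)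
  have vec: "lborel = density (distr lborel borel K) (\<lambda>_. ennreal (1 / c))"
  proof (rule lborel_eqI)
    fix l u :: "real ^ 'a basis_index" assume le: "\<And>b. b \<in> Basis \<Longrightarrow> l \<bullet> b \<le> u \<bullet> b"
    have fb: "emeasure lborel (box l u) < top" using emeasure_lborel_box_finite[of l u] by simp
    have "((\<lambda>x. \<bar>det (matrix (H' x))\<bar>) has_integral c * measure lborel (box l u)) (box l u)"
      unfolding m det using has_integral_mult_right[OF has_integral_measure_lborel, of "box l u" c] fb
      by simp
    then have mH: "H ` box l u \<in> lmeasurable" "measure lebesgue (H ` box l u) = c * measure lborel (box l u)"
      using has_measure_differentiable_image[of "box l u" H H' "c * measure lborel (box l u)"]
        has_derivative_at_withinI[OF H'] KH by (auto simp: inj_on_def) (metis KH(1))+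
    have eq: "K -` box l u = H ` box l u" using KH by (auto simp: image_iff) (metis KH(2))
    have bK: "K -` box l u \<in> sets borel"
      using measurable_sets_borel[of K borel "box l u"] by simp
    have "emeasure lborel (K -` box l u) = emeasure lebesgue (H ` box l u)"
      using bK by (simp add: eq)
    also have "\<dots> = ennreal (c * measure lborel (box l u))"
      using emeasure_eq_measure2[OF mH(1)] mH(2) by simp
    finally have *: "emeasure lborel (K -` box l u) = ennreal (c * measure lborel (box l u))" .
    have "emeasure (density (distr lborel borel K) (\<lambda>_. ennreal (1 / c))) (box l u)
        = ennreal (1 / c) * emeasure lborel (K -` box l u)"
      by (simp add: emeasure_density nn_integral_distr nn_integral_cmult emeasure_distr)
    also have "\<dots> = ennreal (measure lborel (box l u))"
      using \<open>c > 0\<close> by (simp add: * flip: ennreal_mult)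
    also have "\<dots> = emeasure lborel (box l u)"
      using emeasure_lborel_box_finite[of l u] by (simp add: emeasure_eq_ennreal_measure less_top)
    finally show "emeasure (density (distr lborel borel K) (\<lambda>_. ennreal (1 / c))) (box l u) = (\<Prod>b\<in>Basis. (u - l) \<bullet> b)"
      using le by simp
  qed simp
  have tv: "(\<integral>\<^sup>+x. F x \<partial>lborel) = (\<integral>\<^sup>+y. F (of_vec y) \<partial>lborel)"
    if F: "F \<in> borel_measurable borel" for F :: "'a \<Rightarrow> ennreal"
    using F by (subst distr_lborel_to_vec[symmetric]) (simp add: nn_integral_distr)
  have Fh: "(\<lambda>x. F (h x)) \<in> borel_measurable borel" using F by measurable
  have "(\<integral>\<^sup>+x. F (h x) \<partial>lborel) = (\<integral>\<^sup>+y. F (h (of_vec y)) \<partial>lborel)" by (rule tv[OF Fh])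
  also have "\<dots> = (\<integral>\<^sup>+y. F (h (of_vec y)) \<partial>density (distr lborel borel K) (\<lambda>_. ennreal (1 / c)))"
    by (simp flip: vec)
  also have "\<dots> = ennreal (1 / c) * (\<integral>\<^sup>+y. F (h (of_vec (K y))) \<partial>lborel)"
    using F by (simp add: nn_integral_density nn_integral_distr nn_integral_cmult)
  also have "\<dots> = ennreal (1 / c) * (\<integral>\<^sup>+y. F (of_vec y) \<partial>lborel)"
    by (simp add: K_def k)
  also have "\<dots> = ennreal (1 / c) * (\<integral>\<^sup>+x. F x \<partial>lborel)" by (simp add: tv[OF F])
  finally have "ennreal c * (\<integral>\<^sup>+x. F (h x) \<partial>lborel) = (ennreal c * ennreal (1 / c)) * (\<integral>\<^sup>+x. F x \<partial>lborel)"
    by (simp add: mult.assoc)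
  also have "ennreal c * ennreal (1 / c) = 1" using \<open>c > 0\<close> by (simp flip: ennreal_mult)
  finally show ?thesis by simp
qed

section \<open>Haar measure\<close>

lemma haar_measure_nn_integral_translate:
  fixes M :: "'g::{topological_group_add,t2_space,second_countable_topology} measure"
  assumes "haar_measure M" "F \<in> borel_measurable borel"
  shows "(\<integral>\<^sup>+x. F (y + x) \<partial>M) = (\<integral>\<^sup>+x. F x \<partial>M)"
proof -
  have sM [measurable_cong]: "sets M = sets borel" and inv: "\<And>y E. E \<in> sets M \<Longrightarrow> emeasure M ((+) y ` E) = emeasure M E"
    using assms(1) by (auto simp: haar_measure_def)
  have tr [measurable]: "(+) y \<in> measurable M M" for y :: 'g
    by (auto intro!: borel_measurable_continuous_onI continuous_intros cong: measurable_cong_sets simp: measurable_cong_sets[OF sM sM])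
  have "distr M M ((+) y) = M"
  proof (rule measure_eqI)
    fix E assume "E \<in> sets (distr M M ((+) y))"
    then have E: "E \<in> sets M" by simp
    have "(+) y -` E \<inter> space M = (+) (- y) ` E"
    proof -
      have "space M = UNIV" using sets_eq_imp_space_eq[OF sM] by simp
      then show ?thesis by (auto simp: image_iff) (metis add.assoc add.left_inverse add_0)+
    qed
    then show "emeasure (distr M M ((+) y)) E = emeasure M E" using E inv by (simp add: emeasure_distr)
  qed simp
  then have "(\<integral>\<^sup>+x. F x \<partial>M) = (\<integral>\<^sup>+x. F x \<partial>distr M M ((+) y))" by simp
  also have "\<dots> = (\<integral>\<^sup>+x. F (y + x) \<partial>M)" using assms(2) by (intro nn_integral_distr) (auto cong: measurable_cong_sets simp: measurable_cong_sets[OF sM refl])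
  finally show ?thesis by simp
qed

text \<open>The integral of \<open>f x * g (y + x) / G x\<close> is transformed by \<open>x \<mapsto> - y + x\<close> and then
  \<open>y \<mapsto> x + y\<close>. The factor depending on \<open>f\<close> no longer involves \<open>M\<close>, which gives uniqueness.\<close>

lemma haar_measure_factorisation:
  fixes M N :: "'g::{topological_group_add,t2_space,second_countable_topology} measure"
  assumes M: "haar_measure M" "sigma_finite_measure M" and N: "haar_measure N" "sigma_finite_measure N"
    and [measurable]: "g \<in> borel_measurable borel" "f \<in> borel_measurable borel"
  defines "G \<equiv> \<lambda>x. \<integral>\<^sup>+t. g (t + x) \<partial>N"
  assumes G: "\<And>x. G x \<noteq> 0" "\<And>x. G x \<noteq> \<infinity>"
  shows "(\<integral>\<^sup>+x. f x \<partial>M) = (\<integral>\<^sup>+x. g x \<partial>M) * (\<integral>\<^sup>+y. f (- y) / G (- y) \<partial>N)"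
proof -
  interpret M: sigma_finite_measure M by fact
  interpret N: sigma_finite_measure N by fact
  interpret P: pair_sigma_finite M N ..
  have sM [measurable_cong]: "sets M = sets borel" and sN [measurable_cong]: "sets N = sets borel"
    using M N by (auto simp: haar_measure_def)
  have [measurable]: "(uminus :: 'g \<Rightarrow> 'g) \<in> borel_measurable borel"
    by (intro borel_measurable_continuous_onI continuous_intros)
  have "(\<lambda>x. G x) \<in> borel_measurable borel"
    unfolding G_def by measurable
  note [measurable] = this
  have "(\<integral>\<^sup>+x. f x \<partial>M) = (\<integral>\<^sup>+x. \<integral>\<^sup>+y. f x / G x * g (y + x) \<partial>N \<partial>M)"
  proof (rule nn_integral_cong)
    fix x
    have "(\<integral>\<^sup>+y. f x / G x * g (y + x) \<partial>N) = f x / G x * G x"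
      unfolding G_def by (rule nn_integral_cmult) measurable
    also have "\<dots> = f x" using G[of x] by (simp add: ennreal_divide_times ennreal_divide_self less_top divide_mult_eq)
    finally show "f x = (\<integral>\<^sup>+y. f x / G x * g (y + x) \<partial>N)" by simp
  qed
  also have "\<dots> = (\<integral>\<^sup>+y. \<integral>\<^sup>+x. f x / G x * g (y + x) \<partial>M \<partial>N)"
    by (rule P.Fubini'[symmetric]) measurable
  also have "\<dots> = (\<integral>\<^sup>+y. \<integral>\<^sup>+x. f (- y + x) / G (- y + x) * g x \<partial>M \<partial>N)"
  proof (rule nn_integral_cong)
    fix y
    have "(\<integral>\<^sup>+x. f (- y + x) / G (- y + x) * g (y + (- y + x)) \<partial>M) = (\<integral>\<^sup>+x. f x / G x * g (y + x) \<partial>M)"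
      by (rule haar_measure_nn_integral_translate[OF M(1), of "\<lambda>x. f x / G x * g (y + x)"]) measurable
    then show "(\<integral>\<^sup>+x. f x / G x * g (y + x) \<partial>M) = (\<integral>\<^sup>+x. f (- y + x) / G (- y + x) * g x \<partial>M)"
      by (simp flip: add.assoc)
  qed
  also have "\<dots> = (\<integral>\<^sup>+x. \<integral>\<^sup>+y. f (- y + x) / G (- y + x) * g x \<partial>N \<partial>M)"
    by (rule P.Fubini') measurable
  also have "\<dots> = (\<integral>\<^sup>+x. \<integral>\<^sup>+y. f (- y) / G (- y) * g x \<partial>N \<partial>M)"
  proof (rule nn_integral_cong)
    fix x
    have "(\<integral>\<^sup>+y. f (- (x + y) + x) / G (- (x + y) + x) * g x \<partial>N) = (\<integral>\<^sup>+y. f (- y + x) / G (- y + x) * g x \<partial>N)"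
      by (rule haar_measure_nn_integral_translate[OF N(1), of "\<lambda>y. f (- y + x) / G (- y + x) * g x"]) measurable
    then show "(\<integral>\<^sup>+y. f (- y + x) / G (- y + x) * g x \<partial>N) = (\<integral>\<^sup>+y. f (- y) / G (- y) * g x \<partial>N)"
      by (simp add: minus_add add.assoc)
  qed
  also have "\<dots> = (\<integral>\<^sup>+x. (\<integral>\<^sup>+y. f (- y) / G (- y) \<partial>N) * g x \<partial>M)"
    by (intro nn_integral_cong nn_integral_multc) measurable
  also have "\<dots> = (\<integral>\<^sup>+x. g x \<partial>M) * (\<integral>\<^sup>+y. f (- y) / G (- y) \<partial>N)"
    by (subst nn_integral_cmult) (auto simp: mult.commute)
  finally show ?thesis .
qed

text \<open>The factorisations for the pairs \<open>M\<close>, \<open>N\<close> and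
  \<open>N\<close>, \<open>N\<close> share the second factor \<open>C\<close>, which is then
  eliminated. Invariance is on the left, so the measure of the right translates of \<open>K\<close>
  may vary with \<open>x\<close>; that it is positive and finite makes the divisor in the
  factorisation legitimate.\<close>

lemma haar_measure_unique:
  fixes M N :: "'g::{topological_group_add,t2_space,second_countable_topology} measure"
  assumes M: "haar_measure M" "sigma_finite_measure M" and N: "haar_measure N" "sigma_finite_measure N"
    and K: "compact K" "\<And>x. emeasure N ((\<lambda>t. t + x) -` K) \<noteq> 0"
    and f: "f \<in> borel_measurable borel"
  shows "(\<integral>\<^sup>+x. f x \<partial>M) = emeasure M K / emeasure N K * (\<integral>\<^sup>+x. f x \<partial>N)"
proof -
  have sM: "sets M = sets borel" and sN: "sets N = sets borel"
    using M N by (auto simp: haar_measure_def)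
  have Kb: "K \<in> sets borel" using K(1) by (simp add: compact_imp_closed)
  define g where "g = (indicator K :: 'g \<Rightarrow> ennreal)"
  have g: "g \<in> borel_measurable borel" using Kb by (simp add: g_def)
  have G: "(\<integral>\<^sup>+t. g (t + x) \<partial>N) = emeasure N ((\<lambda>t. t + x) -` K)" for x
  proof -
    have m: "(\<lambda>t. t + x) -` K \<in> sets N"
      using measurable_sets_borel[of "\<lambda>t. t + x" borel K] Kb sN
      by (simp add: borel_measurable_continuous_onI continuous_intros)
    have "(\<integral>\<^sup>+t. g (t + x) \<partial>N) = (\<integral>\<^sup>+t. indicator ((\<lambda>t. t + x) -` K) t \<partial>N)"
      by (simp add: g_def indicator_def vimage_def)
    then show ?thesis using m by simp
  qed
  have fin: "emeasure N ((\<lambda>t. t + x) -` K) < \<infinity>" for x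
  proof -
    have "(\<lambda>t. t + x) -` K = (\<lambda>t. t + - x) ` K"
    proof (intro set_eqI iffI)
      fix t assume "t \<in> (\<lambda>t. t + x) -` K"
      then show "t \<in> (\<lambda>t. t + - x) ` K"
        by (intro image_eqI[of _ _ "t + x"]) (simp_all add: add.assoc del: add_uminus_conv_diff)
    qed (auto simp: add.assoc simp del: add_uminus_conv_diff)
    moreover have "compact ((\<lambda>t. t + - x) ` K)"
      by (intro compact_continuous_image continuous_intros K)
    ultimately show ?thesis using N(1) by (auto simp: haar_measure_def)
  qed
  define C where "C = (\<integral>\<^sup>+y. f (- y) / (\<integral>\<^sup>+t. g (t + - y) \<partial>N) \<partial>N)"
  have "(\<integral>\<^sup>+x. f x \<partial>M) = (\<integral>\<^sup>+x. g x \<partial>M) * C"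
    unfolding C_def by (rule haar_measure_factorisation[OF M N g f]) (use K(2) fin in \<open>auto simp: G less_top\<close>)
  then have 1: "(\<integral>\<^sup>+x. f x \<partial>M) = emeasure M K * C" using Kb sM by (simp add: g_def)
  have "(\<integral>\<^sup>+x. f x \<partial>N) = (\<integral>\<^sup>+x. g x \<partial>N) * C"
    unfolding C_def by (rule haar_measure_factorisation[OF N N g f]) (use K(2) fin in \<open>auto simp: G less_top\<close>)
  then have 2: "(\<integral>\<^sup>+x. f x \<partial>N) = emeasure N K * C" using Kb sN by (simp add: g_def)
  have "emeasure N K \<noteq> 0" "emeasure N K < \<infinity>" using K(2)[of 0] fin[of 0] by auto
  then have "emeasure N K / emeasure N K = 1" by (intro ennreal_divide_self) auto
  then have "emeasure M K * (emeasure N K / emeasure N K) * C = emeasure M K * C" by simp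
  then have "emeasure M K / emeasure N K * (emeasure N K * C) = emeasure M K * C"
    by (simp only: divide_ennreal_def mult_ac)
  with 1 2 show ?thesis by simp
qed

section \<open>Dilations and the Jacobians of translations\<close>

context homogeneous_lie_group
begin

lemma eigenbasis:
  obtains B c where "independent B" "span B = UNIV" "\<And>b. b \<in> B \<Longrightarrow> A b = c b *\<^sub>R b" "\<And>b. b \<in> B \<Longrightarrow> c b > 0"
proof -
  obtain B where B: "independent B" "span B = UNIV" "\<forall>b\<in>B. \<exists>c. A b = c *\<^sub>R b"
    using homogeneous by (auto simp: homogeneous_group_def diagonalisable_def)
  then obtain c where c: "\<And>b. b \<in> B \<Longrightarrow> A b = c b *\<^sub>R b" by metis
  have "c b > 0" if "b \<in> B" for b
  proof -
    have "b \<noteq> 0" using that B(1) dependent_zero by blast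
    then show ?thesis using homogeneous c[OF that] by (auto simp: homogeneous_group_def)
  qed
  with that B c show ?thesis by blast
qed

lemma linear_generator: "linear A"
  using homogeneous by (simp add: homogeneous_group_def)

lemma linear_dilation: "r > 0 \<Longrightarrow> linear (D r)"
  using homogeneous by (simp add: homogeneous_group_def lie_algebra_morphism_def)

lemma dilation_one: "D 1 v = v"
proof -
  obtain B c where B: "independent B" "span B = UNIV" "\<And>b. b \<in> B \<Longrightarrow> A b = c b *\<^sub>R b" by (metis eigenbasis)
  have "D 1 v = (\<Sum>b\<in>B. representation B v b *\<^sub>R b)"
    using eigenbasis_dilation[OF linear_generator B, of 1] by simp
  then show ?thesis
    using real_vector.sum_representation_eq[OF B(1) _ independent_imp_finite[OF B(1)] subset_refl, of v] B(2) by simp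
qed

lemma dilation_eigenvector:
  assumes "A b = c *\<^sub>R b" "r > 0" shows "D r b = (r powr c) *\<^sub>R b"
proof -
  have "(A ^^ k) b = c ^ k *\<^sub>R b" for k
    by (induction k) (simp_all add: linear_cmul[OF linear_generator] assms(1))
  then have "(ln r ^ k / fact k) *\<^sub>R (A ^^ k) b = ((c * ln r) ^ k /\<^sub>R fact k) *\<^sub>R b" for k
    by (simp add: power_mult_distrib field_simps)
  moreover have "(\<lambda>k. ((c * ln r) ^ k /\<^sub>R fact k) *\<^sub>R b) sums (exp (c * ln r) *\<^sub>R b)"
    by (intro sums_scaleR_left exp_converges)
  ultimately show ?thesis using assms(2) by (simp add: algebra_dilation_def sums_iff powr_def)
qed

lemma dilation_dilation:
  assumes "r > 0" "s > 0" shows "D r (D s v) = D (r * s) v"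
proof -
  obtain B c where B: "independent B" "span B = UNIV" "\<And>b. b \<in> B \<Longrightarrow> A b = c b *\<^sub>R b" by (metis eigenbasis)
  have "D r (D s v) = D r (\<Sum>b\<in>B. (representation B v b * s powr c b) *\<^sub>R b)"
    by (simp only: eigenbasis_dilation[OF linear_generator B \<open>s > 0\<close>])
  also have "\<dots> = (\<Sum>b\<in>B. (representation B v b * s powr c b) *\<^sub>R ((r powr c b) *\<^sub>R b))"
    using assms(1) by (simp add: linear_sum[OF linear_dilation] linear_cmul[OF linear_dilation]
        dilation_eigenvector[OF B(3)])
  also have "\<dots> = D (r * s) v"
    using assms by (simp add: eigenbasis_dilation[OF linear_generator B] powr_mult mult_ac)
  finally show ?thesis .
qed

lemma dilation_inverse: "r > 0 \<Longrightarrow> D r (D (1 / r) v) = v" "r > 0 \<Longrightarrow> D (1 / r) (D r v) = v"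
  by (simp_all add: dilation_dilation dilation_one)

lemma det_dilation:
  assumes "r > 0" shows "det (eucl_matrix (D r)) = r powr operator_trace A"
proof -
  obtain B c where B: "independent B" "span B = UNIV" "\<And>b. b \<in> B \<Longrightarrow> A b = c b *\<^sub>R b" by (metis eigenbasis)
  have "det (eucl_matrix (D r)) = (\<Prod>b\<in>B. r powr c b)"
    by (rule eigenbasis_det_trace(1)[OF B(1,2) linear_dilation[OF assms] dilation_eigenvector[OF B(3) assms]])
  also have "\<dots> = r powr (\<Sum>b\<in>B. c b)"
    using assms by (simp add: powr_sum independent_imp_finite[OF B(1)])
  also have "(\<Sum>b\<in>B. c b) = operator_trace A"
    by (rule eigenbasis_det_trace(2)[OF B(1,2) linear_generator B(3), symmetric])
  finally show ?thesis .
qed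

text \<open>In logarithmic time the scale ranges over the whole line, so joint continuity holds on a
  full product space.\<close>

lemma continuous_dilation: "continuous_on UNIV (\<lambda>z. D (exp (fst z)) (snd z))"
proof -
  obtain B c where B: "independent B" "span B = UNIV" "\<And>b. b \<in> B \<Longrightarrow> A b = c b *\<^sub>R b" by (metis eigenbasis)
  have "continuous_on UNIV (\<lambda>v. representation B v b)" for b
  proof -
    have "linear (\<lambda>v. representation B v b)"
      using B(1,2) by (intro linearI) (simp_all add: real_vector.representation_add real_vector.representation_scale)
    then show ?thesis by (simp add: linear_continuous_on linear_conv_bounded_linear)
  qed
  from continuous_on_compose2[OF this continuous_on_snd[OF continuous_on_id]] show ?thesis
    by (simp add: eigenbasis_dilation[OF linear_generator B]) (intro continuous_intros, auto)
qed

lemma dilation_flow: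
  "((\<lambda>t. D (exp t) v) has_vector_derivative A (D (exp t) v)) (at t)"
proof -
  obtain B c where B: "independent B" "span B = UNIV" "\<And>b. b \<in> B \<Longrightarrow> A b = c b *\<^sub>R b" by (metis eigenbasis)
  have "((\<lambda>t. \<Sum>b\<in>B. (representation B v b * exp (c b * t)) *\<^sub>R b) has_vector_derivative
      (\<Sum>b\<in>B. (representation B v b * (exp (c b * t) * c b)) *\<^sub>R b)) (at t)"
    by (auto intro!: has_vector_derivative_sum derivative_eq_intros)
  then show ?thesis
    by (simp add: eigenbasis_dilation[OF linear_generator B] linear_sum[OF linear_generator]
        linear_cmul[OF linear_generator] B(3) exp_powr_real powr_def mult_ac)
qed

text \<open>Every eigenvalue is positive, so each summand of the eigenbasis formula decays.\<close>

lemma dilation_tendsto_zero: "((\<lambda>t. D (exp (- t)) v) \<longlongrightarrow> 0) at_top"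
proof -
  obtain B c where B: "independent B" "span B = UNIV" "\<And>b. b \<in> B \<Longrightarrow> A b = c b *\<^sub>R b"
    and c: "\<And>b. b \<in> B \<Longrightarrow> c b > 0" by (metis eigenbasis)
  have "((\<lambda>t. exp (- (c b * t))) \<longlongrightarrow> 0) at_top" if "b \<in> B" for b
    by (intro filterlim_compose[OF exp_at_bot] filterlim_compose[OF filterlim_uminus_at_bot_at_top]
        filterlim_tendsto_pos_mult_at_top[OF tendsto_const c[OF that] filterlim_ident])
  then have "((\<lambda>t. \<Sum>b\<in>B. (representation B v b * exp (- (c b * t))) *\<^sub>R b) \<longlongrightarrow> (\<Sum>b\<in>B. (representation B v b * 0) *\<^sub>R b)) at_top"
    by (intro tendsto_intros)
  then show ?thesis
    by (simp add: eigenbasis_dilation[OF linear_generator B] powr_def)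
qed

text \<open>\<open>frame\<close> is conjugated into itself by the dilations, so its determinant is invariant
  under them. Contracting to the unit shows that it is constant.\<close>

lemma det_frame: "det (eucl_matrix (frame x)) = 1"
proof -
  have inv: "det (eucl_matrix (frame (D r x))) = det (eucl_matrix (frame x))" if r: "r > 0" for r
  proof -
    have "eucl_matrix (frame (D r x)) ** eucl_matrix (D r) = eucl_matrix (D r) ** eucl_matrix (frame x)"
      using linear_dilation[OF r] bounded_linear.linear[OF bounded_linear_frame]
      by (simp flip: eucl_matrix_mult add: frame_dilation[OF r])
    then have "det (eucl_matrix (frame (D r x))) * det (eucl_matrix (D r)) = det (eucl_matrix (D r)) * det (eucl_matrix (frame x))"
      by (metis det_mul)
    then show ?thesis using det_dilation[OF r] r by simp
  qed
  have "continuous_on UNIV (\<lambda>x. eucl_matrix (frame x) $ i $ j)" for i j :: "'a basis_index"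
    unfolding eucl_matrix_def vec_lambda_beta
    by (intro continuous_intros smooth_on_imp_continuous_on smooth_frame)
  then have "continuous_on UNIV (\<lambda>x. det (eucl_matrix (frame x)))"
    unfolding det_def by (intro continuous_on_sum continuous_on_mult continuous_on_prod continuous_on_const)
  then have "isCont (\<lambda>x. det (eucl_matrix (frame x))) 0"
    by (simp add: continuous_on_eq_continuous_at)
  from isCont_tendsto_compose[OF this dilation_tendsto_zero[of x]]
  have "((\<lambda>t::real. det (eucl_matrix (frame x))) \<longlongrightarrow> det (eucl_matrix (frame 0))) at_top"
    by (simp add: inv)
  moreover have "frame 0 = (\<lambda>x. x)" by auto
  ultimately have "((\<lambda>t::real. det (eucl_matrix (frame x))) \<longlongrightarrow> 1) at_top"
    by (simp add: eucl_matrix_ident)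
  then show ?thesis using tendsto_unique[OF _ tendsto_const] by (metis trivial_limit_at_top_linorder)
qed

text \<open>By left-invariance the differential carries the frame at \<open>y\<close> to the frame
  at \<open>law x y\<close>, and both have determinant 1.\<close>

lemma det_translation_derivative: "det (eucl_matrix (translation_derivative x y)) = 1"
proof -
  have "eucl_matrix (translation_derivative x y) ** eucl_matrix (frame y) = eucl_matrix (frame (law x y))"
    using bounded_linear.linear[OF bounded_linear_translation]
    by (simp flip: eucl_matrix_mult add: translation_frame)
  then show ?thesis by (metis det_frame det_mul mult.right_neutral)
qed

lemma nn_integral_law:
  assumes "F \<in> borel_measurable borel"
  shows "(\<integral>\<^sup>+v. F (law u v) \<partial>lborel) = (\<integral>\<^sup>+v. F v \<partial>lborel)"
proof -
  have "continuous_on UNIV (law (- u))"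
    by (intro continuous_at_imp_continuous_on ballI has_derivative_continuous[OF has_derivative_translation])
  from nn_integral_const_Jacobian[where h="law u" and c=1, OF has_derivative_translation _ _ _ _ this assms]
  show ?thesis using cancel_left[of "- u"] by (simp add: det_translation_derivative)
qed

lemma nn_integral_dilation:
  assumes "F \<in> borel_measurable borel" "r > 0"
  shows "(\<integral>\<^sup>+v. F v \<partial>lborel) = ennreal (r powr operator_trace A) * (\<integral>\<^sup>+v. F (D r v) \<partial>lborel)"
  using assms linear_dilation
  by (intro nn_integral_const_Jacobian[where h'="\<lambda>_. D r" and k="D (1 / r)"])
    (auto simp: det_dilation dilation_inverse linear_conv_bounded_linear
      intro!: bounded_linear_imp_has_derivative linear_continuous_on)

lemma borel_e [measurable]: "e \<in> borel_measurable borel"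
  by (intro borel_measurable_continuous_onI continuous_e)

section \<open>Lebesgue measure transported by the exponential map\<close>

definition lebesgue_haar :: "'g measure" where
  "lebesgue_haar = distr lborel borel e"

lemma sets_lebesgue_haar: "sets lebesgue_haar = sets borel" by (simp add: lebesgue_haar_def)

lemma nn_integral_lebesgue_haar:
  "F \<in> borel_measurable borel \<Longrightarrow> (\<integral>\<^sup>+x. F x \<partial>lebesgue_haar) = (\<integral>\<^sup>+v. F (e v) \<partial>lborel)"
  unfolding lebesgue_haar_def by (rule nn_integral_distr) auto

lemma emeasure_lebesgue_haar: "E \<in> sets borel \<Longrightarrow> emeasure lebesgue_haar E = emeasure lborel (e -` E)"
  unfolding lebesgue_haar_def by (simp add: emeasure_distr)

lemma vimage_e: "e -` E = inv e ` E"
  by (auto simp: image_iff) (metis inv_e)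

lemma emeasure_lebesgue_haar_open:
  assumes "open V" "V \<noteq> {}" shows "emeasure lebesgue_haar V \<noteq> 0"
proof -
  have "open (e -` V)" using assms(1) continuous_e by (rule open_vimage)
  moreover have "e -` V \<noteq> {}" using assms(2) by (simp add: vimage_e)
  ultimately have "\<not> negligible (e -` V)" using open_not_negligible by blast
  moreover have "e -` V \<in> sets borel" using \<open>open (e -` V)\<close> by simp
  ultimately show ?thesis
    using assms(1) by (auto simp: emeasure_lebesgue_haar negligible_iff_null_sets null_sets_def)
qed

lemma image_plus: "(+) y ` E = (+) (- y) -` (E :: 'g set)"
proof (intro set_eqI iffI)
  fix x assume "x \<in> (+) (- y) -` E"
  then show "x \<in> (+) y ` E" by (intro image_eqI[of _ _ "- y + x"]) (simp_all flip: add.assoc)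
qed (auto simp flip: add.assoc)

lemma haar_measure_lebesgue_haar: "haar_measure lebesgue_haar"
  unfolding haar_measure_def
proof (intro conjI allI ballI impI)
  show "emeasure lebesgue_haar UNIV \<noteq> 0" by (rule emeasure_lebesgue_haar_open) auto
  fix K :: "'g set" assume K: "compact K"
  then have "compact (e -` K)"
    unfolding vimage_e by (intro compact_continuous_image continuous_on_subset[OF continuous_inv_e]) auto
  then show "emeasure lebesgue_haar K < \<infinity>"
    using K emeasure_bounded_finite[OF compact_imp_bounded, of "e -` K"]
    by (simp add: emeasure_lebesgue_haar compact_imp_closed)
next
  fix y :: 'g and E assume "E \<in> sets lebesgue_haar"
  then have E: "E \<in> sets borel" by (simp add: sets_lebesgue_haar)
  have yE: "(+) y ` E \<in> sets borel"
    unfolding image_plus using measurable_sets_borel[of "(+) (- y)" borel E] E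
    by (simp add: borel_measurable_continuous_onI continuous_intros)
  have m: "(\<lambda>v. indicator E (e v) :: ennreal) \<in> borel_measurable borel" using E by measurable
  have "emeasure lebesgue_haar ((+) y ` E) = (\<integral>\<^sup>+x. indicator ((+) y ` E) x \<partial>lebesgue_haar)"
    using yE by (simp add: sets_lebesgue_haar)
  also have "\<dots> = (\<integral>\<^sup>+v. indicator ((+) y ` E) (e v) \<partial>lborel)" using yE by (simp add: nn_integral_lebesgue_haar)
  also have "\<dots> = (\<integral>\<^sup>+v. indicator E (e (law (inv e (- y)) v)) \<partial>lborel)"
    unfolding image_plus by (simp add: e_law indicator_def)
  also have "\<dots> = (\<integral>\<^sup>+v. indicator E (e v) \<partial>lborel)" by (rule nn_integral_law[OF m])
  also have "\<dots> = emeasure lebesgue_haar E"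
    using E by (simp flip: nn_integral_lebesgue_haar add: sets_lebesgue_haar)
  finally show "emeasure lebesgue_haar ((+) y ` E) = emeasure lebesgue_haar E" .
qed (rule sets_lebesgue_haar)

text \<open>The exponential images of the closed balls of integer radius are compact and exhaust the
  group.\<close>

lemma sigma_finite_haar:
  assumes "haar_measure M" shows "sigma_finite_measure (M :: 'g measure)"
proof -
  have sM: "sets M = sets borel" and fin: "\<And>K. compact K \<Longrightarrow> emeasure M K < \<infinity>"
    using assms by (auto simp: haar_measure_def)
  have c: "compact (e ` cball 0 (real n))" for n
    by (intro compact_continuous_image continuous_on_subset[OF continuous_e]) auto
  have "space M = (\<Union>n. e ` cball 0 (real n))"
  proof -
    have "x \<in> (\<Union>n. e ` cball 0 (real n))" for x
    proof -
      obtain n where "norm (inv e x) \<le> real n" using real_arch_simple by blast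
      then show ?thesis by (auto intro!: exI[of _ n] image_eqI[of _ _ "inv e x"])
    qed
    then show ?thesis using sets_eq_imp_space_eq[OF sM] by auto
  qed
  then show ?thesis
    using c fin sM
    by unfold_locales (auto intro!: exI[of _ "range (\<lambda>n. e ` cball 0 (real n))"] simp: compact_imp_closed less_top)
qed

lemma haar_measure_eq_lebesgue:
  assumes "haar_measure M"
  obtains c where "\<And>F. F \<in> borel_measurable borel \<Longrightarrow> (\<integral>\<^sup>+x. F x \<partial>M) = c * (\<integral>\<^sup>+v. F (e v) \<partial>lborel)"
proof -
  \<comment> \<open>The exponential image of the closed unit ball contains an open neighbourhood of
    the unit, so each of its right translates has positive measure, as uniqueness demands.\<close>
  define K where "K = e ` cball 0 1"
  have K: "compact K" unfolding K_def
    by (intro compact_continuous_image continuous_on_subset[OF continuous_e]) auto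
  have "emeasure lebesgue_haar ((\<lambda>t. t + x) -` K) \<noteq> 0" for x
  proof -
    have ball: "open (inv e -` ball 0 1)" by (intro open_vimage continuous_inv_e) auto
    have sub: "inv e -` ball 0 1 \<subseteq> K"
      by (force simp: K_def intro!: image_eqI[of _ e "inv e _"])
    have o: "open ((\<lambda>t. t + x) -` (inv e -` ball 0 1))"
      by (intro open_vimage[OF ball] continuous_intros)
    have "inv e 0 = 0" by (metis inv_e e_zero)
    then have "- x \<in> (\<lambda>t. t + x) -` (inv e -` ball 0 1)" by simp
    then have "emeasure lebesgue_haar ((\<lambda>t. t + x) -` (inv e -` ball 0 1)) \<noteq> 0"
      using emeasure_lebesgue_haar_open[OF o] by blast
    moreover have "emeasure lebesgue_haar ((\<lambda>t. t + x) -` (inv e -` ball 0 1)) \<le> emeasure lebesgue_haar ((\<lambda>t. t + x) -` K)"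
    proof (rule emeasure_mono)
      have "closed ((\<lambda>t. t + x) -` K)"
        by (intro closed_vimage compact_imp_closed K continuous_intros)
      then show "(\<lambda>t. t + x) -` K \<in> sets lebesgue_haar" by (simp add: sets_lebesgue_haar)
    qed (use sub in auto)
    ultimately show ?thesis by auto
  qed
  from haar_measure_unique[OF assms sigma_finite_haar[OF assms] haar_measure_lebesgue_haar
      sigma_finite_haar[OF haar_measure_lebesgue_haar] K this] that
  show ?thesis by (metis nn_integral_lebesgue_haar)
qed

text \<open>The unknown factor between Haar and Lebesgue measure occurs on both sides, so the
  scaling of Lebesgue measure carries over.\<close>

lemma haar_measure_dilation:
  assumes "haar_measure M" "F \<in> borel_measurable borel" "r > 0"
  shows "(\<integral>\<^sup>+x. F x \<partial>M) = ennreal (r powr operator_trace A) * (\<integral>\<^sup>+x. F (group_dilation e A r x) \<partial>M)"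
proof -
  obtain c where c: "\<And>F. F \<in> borel_measurable borel \<Longrightarrow> (\<integral>\<^sup>+x. F x \<partial>M) = c * (\<integral>\<^sup>+v. F (e v) \<partial>lborel)"
    using haar_measure_eq_lebesgue[OF assms(1)] by blast
  have "continuous_on UNIV (group_dilation e A r)"
    unfolding group_dilation_def
    using continuous_on_compose2[OF linear_continuous_on[OF linear_dilation[OF assms(3), unfolded linear_conv_bounded_linear]] continuous_inv_e]
    by (intro continuous_on_compose2[OF continuous_e]) auto
  then have [measurable]: "group_dilation e A r \<in> borel_measurable borel"
    by (rule borel_measurable_continuous_onI)
  have F: "(\<lambda>v. F (e v)) \<in> borel_measurable borel" and Fd: "(\<lambda>x. F (group_dilation e A r x)) \<in> borel_measurable borel"
    using assms(2) by measurable
  have "(\<integral>\<^sup>+x. F x \<partial>M) = c * (ennreal (r powr operator_trace A) * (\<integral>\<^sup>+v. F (e (D r v)) \<partial>lborel))"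
    by (simp add: c[OF assms(2)] nn_integral_dilation[OF F assms(3)])
  also have "(\<integral>\<^sup>+v. F (e (D r v)) \<partial>lborel) = (\<integral>\<^sup>+v. F (group_dilation e A r (e v)) \<partial>lborel)"
    by (simp add: group_dilation_def)
  finally show ?thesis by (simp add: c[OF Fd] mult_ac)
qed

end

section \<open>Powers of extended nonnegative reals and Hoelder's inequality\<close>

text \<open>The outer power in \<open>Lp_norm\<close>. Infinity is a separate case because
  \<open>enn2real\<close> sends it to 0; keeping it infinite for every \<open>s\<close> makes
  \<open>epow\<close> multiplicative for all exponents.\<close>

definition epow :: "ennreal \<Rightarrow> real \<Rightarrow> ennreal" where
  "epow I s = (if I = \<infinity> then \<infinity> else ennreal (enn2real I powr s))"

lemma Lp_norm_epow: "Lp_norm M p h = epow (\<integral>\<^sup>+x. ennreal (cmod (h x) powr p) \<partial>M) (1 / p)"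
  by (simp add: Lp_norm_def epow_def Let_def)

lemma epow_ennreal [simp]: "0 \<le> x \<Longrightarrow> epow (ennreal x) s = ennreal (x powr s)"
  by (simp add: epow_def)

lemma epow_top [simp]: "epow top s = top"
  by (simp add: epow_def)

lemma epow_zero [simp]: "epow 0 s = 0"
  by (simp add: epow_def)

lemma epow_one [simp]: "epow I 1 = I"
  by (cases I) auto

lemma epow_eq_0_iff [simp]: "epow I s = 0 \<longleftrightarrow> I = 0"
  by (cases I) auto

lemma epow_epow [simp]: "epow (epow I s) t = epow I (s * t)"
  by (cases I) (auto simp: powr_powr)

lemma epow_mono: "I \<le> J \<Longrightarrow> 0 \<le> s \<Longrightarrow> epow I s \<le> epow J s"
  by (cases I; cases J) (auto intro!: ennreal_leI powr_mono2 simp: top_unique)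

lemma epow_mult: "epow (I * J) s = epow I s * epow J s"
proof (cases "I = 0 \<or> J = 0")
  case False
  then show ?thesis
    by (cases I; cases J)
      (auto simp: ennreal_mult_top ennreal_top_mult powr_mult simp flip: ennreal_mult)
qed auto

text \<open>After normalisation by the two norms, Young's inequality is integrated. A vanishing
  integral is treated first: there the right-hand side is 0 even if the other integral is infinite,
  and the product vanishes almost everywhere.\<close>

lemma Hoelder_nn_integral:
  fixes u v :: "'x \<Rightarrow> real"
  assumes "a > 1" "b > 1" "1 / a + 1 / b = 1"
    and [measurable]: "u \<in> borel_measurable M" "v \<in> borel_measurable M"
    and nonneg: "\<And>x. 0 \<le> u x" "\<And>x. 0 \<le> v x"
  shows "(\<integral>\<^sup>+x. ennreal (u x * v x) \<partial>M)
    \<le> epow (\<integral>\<^sup>+x. ennreal (u x powr a) \<partial>M) (1 / a) * epow (\<integral>\<^sup>+x. ennreal (v x powr b) \<partial>M) (1 / b)"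
    (is "?L \<le> epow ?I _ * epow ?J _")
proof -
  have zero: "?L = 0" if "(\<integral>\<^sup>+x. ennreal (u x powr a) \<partial>M) = 0 \<or> (\<integral>\<^sup>+x. ennreal (v x powr b) \<partial>M) = 0"
  proof -
    have "AE x in M. u x * v x = 0"
      using that by (auto simp: nn_integral_0_iff_AE nonneg)
    then show ?thesis by (subst nn_integral_0_iff_AE) auto
  qed
  show ?thesis
  proof (cases "?I = 0 \<or> ?J = 0")
    case True then show ?thesis using zero by simp
  next
    case nz: False
    show ?thesis
    proof (cases "?I = \<infinity> \<or> ?J = \<infinity>")
      case True then show ?thesis using nz by (auto simp: ennreal_mult_top ennreal_top_mult)
    next
      case False
      then obtain I J where I: "?I = ennreal I" "I > 0" and J: "?J = ennreal J" "J > 0"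
        using nz by (cases ?I; cases ?J) (auto simp: less_le)
      have pw: "u x * v x \<le> (I powr (1 / a) * J powr (1 / b)) * (u x powr a / (a * I) + v x powr b / (b * J))" for x
      proof -
        have "(u x / I powr (1 / a)) * (v x / J powr (1 / b))
          \<le> (u x / I powr (1 / a)) powr a / a + (v x / J powr (1 / b)) powr b / b"
          using assms(1-3) nonneg I(2) J(2) by (intro Youngs_inequality) auto
        also have "\<dots> = u x powr a / (a * I) + v x powr b / (b * J)"
          using assms(1,2) nonneg I(2) J(2) by (simp add: powr_divide powr_powr mult.commute)
        finally show ?thesis using I(2) J(2) by (simp add: field_simps)
      qed
      have "?L \<le> (\<integral>\<^sup>+x. ennreal (I powr (1 / a) * J powr (1 / b)) *
          (ennreal (1 / (a * I)) * ennreal (u x powr a) + ennreal (1 / (b * J)) * ennreal (v x powr b)) \<partial>M)"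
      proof (rule nn_integral_mono)
        fix x
        have "ennreal (I powr (1 / a) * J powr (1 / b)) *
          (ennreal (1 / (a * I)) * ennreal (u x powr a) + ennreal (1 / (b * J)) * ennreal (v x powr b))
          = ennreal ((I powr (1 / a) * J powr (1 / b)) * (u x powr a / (a * I) + v x powr b / (b * J)))"
          using I(2) J(2) assms(1,2) by (simp flip: ennreal_mult ennreal_plus)
        then show "ennreal (u x * v x) \<le> ennreal (I powr (1 / a) * J powr (1 / b)) *
          (ennreal (1 / (a * I)) * ennreal (u x powr a) + ennreal (1 / (b * J)) * ennreal (v x powr b))"
          using ennreal_leI[OF pw[of x]] by simp
      qed
      also have "\<dots> = ennreal (I powr (1 / a) * J powr (1 / b)) * (ennreal (1 / (a * I)) * ?I + ennreal (1 / (b * J)) * ?J)"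
        by (simp add: nn_integral_cmult nn_integral_add)
      also have "ennreal (1 / (a * I)) * ?I + ennreal (1 / (b * J)) * ?J = 1"
        unfolding I(1) J(1) using I(2) J(2) assms(1-3)
        by (simp flip: ennreal_mult ennreal_plus)
      finally show ?thesis unfolding I(1) J(1) using I(2) J(2) by (simp add: ennreal_mult)
    qed
  qed
qed

text \<open>The previous inequality for \<open>cmod (u x) powr r\<close> and
  \<open>cmod (v x) powr r\<close>, with the conjugate exponents p / r and q / r.\<close>

lemma Hoelder_Lp_norm:
  assumes "p > 0" "q > 0" "r > 0" "1 / p + 1 / q = 1 / r"
    and "u \<in> borel_measurable M" "v \<in> borel_measurable M"
  shows "Lp_norm M r (\<lambda>x. u x * v x) \<le> Lp_norm M p u * Lp_norm M q v"
proof -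
  have [measurable]: "u \<in> borel_measurable M" "v \<in> borel_measurable M" using assms by auto
  have "1 / p < 1 / r" "1 / q < 1 / r" using assms(1-4) by (auto simp flip: assms(4))
  then have "r < p" "r < q" using assms(1-3) by (simp_all add: field_simps)
  moreover have "1 / (p / r) + 1 / (q / r) = 1"
  proof -
    have "1 / (p / r) + 1 / (q / r) = r * (1 / p + 1 / q)" by (simp add: distrib_left)
    then show ?thesis using assms(3,4) by simp
  qed
  ultimately have "(\<integral>\<^sup>+x. ennreal (cmod (u x) powr r * cmod (v x) powr r) \<partial>M)
    \<le> epow (\<integral>\<^sup>+x. ennreal ((cmod (u x) powr r) powr (p / r)) \<partial>M) (1 / (p / r)) *
      epow (\<integral>\<^sup>+x. ennreal ((cmod (v x) powr r) powr (q / r)) \<partial>M) (1 / (q / r))"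
    using assms(3) by (intro Hoelder_nn_integral) auto
  then have "(\<integral>\<^sup>+x. ennreal (cmod (u x * v x) powr r) \<partial>M)
    \<le> epow (\<integral>\<^sup>+x. ennreal (cmod (u x) powr p) \<partial>M) (r / p) * epow (\<integral>\<^sup>+x. ennreal (cmod (v x) powr q) \<partial>M) (r / q)"
    using assms(3) by (simp add: powr_powr norm_mult powr_mult)
  from epow_mono[OF this, of "1 / r"] show ?thesis
    using assms(1-3) by (simp add: Lp_norm_epow epow_mult)
qed

section \<open>Hardy's inequality on the line\<close>

lemma nn_integral_powr_Icc:
  assumes "a > - 1" "t \<ge> 0"
  shows "(\<integral>\<^sup>+s. ennreal (s powr a) * indicator {0..t} s \<partial>lborel) = ennreal (t powr (a + 1) / (a + 1))"
  by (rule nn_integral_has_integral_lebesgue'[OF _ has_integral_powr_from_0[OF assms]]) auto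

lemma nn_integral_powr_atLeast:
  assumes "a < - 1" "t > 0"
  shows "(\<integral>\<^sup>+s. ennreal (s powr a) * indicator {t..} s \<partial>lborel) = ennreal (t powr (a + 1) / (- a - 1))"
proof -
  have "- (t powr (a + 1)) / (a + 1) = t powr (a + 1) / (- a - 1)"
    using minus_divide_right[of "t powr (a + 1)" "a + 1"] by simp
  with nn_integral_has_integral_lebesgue'[OF _ has_integral_powr_to_inf[OF assms]] show ?thesis by simp
qed

text \<open>Schur's test: Hoelder's inequality against the weight \<open>s powr (1 / (p * p'))\<close>,
  with \<open>1 / p + 1 / p' = 1\<close>, followed by Tonelli's theorem, gives the sharp constant.\<close>

lemma Hardy_half_line:
  fixes k k' :: "real \<Rightarrow> complex"
  assumes p: "p > 1" and k: "\<And>t. (k has_vector_derivative k' t) (at t)" and k': "continuous_on UNIV k'" and "k 0 = 0"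
  shows "(\<integral>\<^sup>+t. ennreal (cmod (k t) powr p / t powr p) * indicator {0<..} t \<partial>lborel)
    \<le> ennreal ((p / (p - 1)) powr p) * (\<integral>\<^sup>+t. ennreal (cmod (k' t) powr p) * indicator {0<..} t \<partial>lborel)"
proof -
  define q where "q = p / (p - 1)"
  \<comment> \<open>With this exponent the weight contributes s^(1/q) to the p-th power of the
    factor with \<open>k'\<close>, and s^(-1/p), still integrable at 0, to the q-th power of the
    other.\<close>
  define \<sigma> where "\<sigma> = 1 / (p * q)"
  have q: "q > 1" "1 / p + 1 / q = 1" using p by (auto simp: q_def field_simps)
  have \<sigma>: "\<sigma> * p = 1 / q" "\<sigma> * q = 1 / p" using p q(1) by (auto simp: \<sigma>_def)
  have [measurable]: "k' \<in> borel_measurable borel" using k' by (rule borel_measurable_continuous_onI)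
  have [measurable]: "k \<in> borel_measurable borel"
    using k by (intro borel_measurable_continuous_onI continuous_at_imp_continuous_on) (auto dest: has_vector_derivative_continuous)
  define H where "H t = (\<integral>\<^sup>+s. ennreal (cmod (k' s) powr p * s powr (1 / q)) * indicator {0<..t} s \<partial>lborel)" for t
  \<comment> \<open>The factor \<open>q * t powr (1 / q)\<close> is the integral of s^(-1/p) over
    [0, t]. Hoelder's inequality puts the exponent 1/q on it, and the p-th power makes that
    p/q.\<close>
  have kt: "ennreal (cmod (k t) powr p) \<le> ennreal ((q * t powr (1 / q)) powr (p / q)) * H t" if t: "t > 0" for t
  proof -
    have "(k' has_integral (k t - k 0)) {0..t}"
      using t by (intro fundamental_theorem_of_calculus has_vector_derivative_at_within[OF k]) auto
    moreover have "(\<lambda>s. cmod (k' s)) integrable_on {0..t}"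
      by (intro integrable_continuous_interval continuous_on_norm continuous_on_subset[OF k']) auto
    ultimately have "cmod (k t) \<le> integral {0..t} (\<lambda>s. cmod (k' s))"
      using \<open>k 0 = 0\<close> integral_norm_bound_integral[of k' "{0..t}" "\<lambda>s. cmod (k' s)"] by (auto simp: has_integral_iff)
    then have "ennreal (cmod (k t)) \<le> ennreal (integral {0..t} (\<lambda>s. cmod (k' s)))" by (rule ennreal_leI)
    also have "\<dots> = (\<integral>\<^sup>+s. ennreal (cmod (k' s)) * indicator {0..t} s \<partial>lborel)"
      by (rule nn_integral_has_integral_lebesgue'[symmetric])
        (auto intro!: integrable_integral integrable_continuous_interval continuous_on_norm continuous_on_subset[OF k'])
    also have "\<dots> = (\<integral>\<^sup>+s. ennreal (cmod (k' s)) * indicator {0<..t} s \<partial>lborel)"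
      by (intro nn_integral_cong_AE) (use AE_lborel_singleton[of "0::real"] in eventually_elim, auto simp: indicator_def)
    also have "\<dots> = (\<integral>\<^sup>+s. ennreal ((cmod (k' s) * s powr \<sigma> * indicator {0<..t} s) * (s powr (- \<sigma>) * indicator {0<..t} s)) \<partial>lborel)"
      by (intro nn_integral_cong) (auto simp: indicator_def powr_minus)
    also have "\<dots> \<le> epow (\<integral>\<^sup>+s. ennreal ((cmod (k' s) * s powr \<sigma> * indicator {0<..t} s) powr p) \<partial>lborel) (1 / p)
        * epow (\<integral>\<^sup>+s. ennreal ((s powr (- \<sigma>) * indicator {0<..t} s) powr q) \<partial>lborel) (1 / q)"
      by (rule Hoelder_nn_integral) (use p q in auto)
    also have "(\<integral>\<^sup>+s. ennreal ((cmod (k' s) * s powr \<sigma> * indicator {0<..t} s) powr p) \<partial>lborel) = H t"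
      unfolding H_def using p
      by (intro nn_integral_cong) (auto simp: indicator_def powr_mult powr_powr \<sigma>)
    also have "(\<integral>\<^sup>+s. ennreal ((s powr (- \<sigma>) * indicator {0<..t} s) powr q) \<partial>lborel)
        = (\<integral>\<^sup>+s. ennreal (s powr (- (1 / p))) * indicator {0..t} s \<partial>lborel)"
      by (intro nn_integral_cong) (auto simp: indicator_def powr_powr \<sigma>)
    also have "\<dots> = ennreal (t powr (- (1 / p) + 1) / (- (1 / p) + 1))"
      using p t by (intro nn_integral_powr_Icc) auto
    also have "- (1 / p) + 1 = 1 / q" using q(2) by simp
    finally have "ennreal (cmod (k t)) \<le> epow (H t) (1 / p) * epow (ennreal (t powr (1 / q) / (1 / q))) (1 / q)" .
    from epow_mono[OF this, of p] show ?thesis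
      using p q(1) t by (simp add: epow_mult mult.commute powr_powr)
  qed
  have "(\<integral>\<^sup>+t. ennreal (cmod (k t) powr p / t powr p) * indicator {0<..} t \<partial>lborel)
      \<le> (\<integral>\<^sup>+t. \<integral>\<^sup>+s. ennreal (q powr (p / q) * t powr (- 1 - 1 / q)) * indicator {s..} t *
          (ennreal (cmod (k' s) powr p * s powr (1 / q)) * indicator {0<..} s) \<partial>lborel \<partial>lborel)"
  proof (rule nn_integral_mono)
    fix t :: real
    show "ennreal (cmod (k t) powr p / t powr p) * indicator {0<..} t \<le>
      (\<integral>\<^sup>+s. ennreal (q powr (p / q) * t powr (- 1 - 1 / q)) * indicator {s..} t *
          (ennreal (cmod (k' s) powr p * s powr (1 / q)) * indicator {0<..} s) \<partial>lborel)"
    proof (cases "t > 0")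
      case True
      \<comment> \<open>This is the power of \<open>t\<close> left for Tonelli's theorem: its
        integral over the tail from \<open>s\<close> is q s^(-1/q), which cancels the weight s^(1/q)
        in \<open>H\<close>.\<close>
      have e: "(1 / q) * (p / q) + (- p) = - 1 - 1 / q"
      proof -
        have "1 / q = 1 - 1 / p" using q(2) by simp
        moreover have "(1 / q) * (p / q) + (- p) = p * (1 / q)\<^sup>2 - p" by (simp add: power2_eq_square)
        ultimately have "(1 / q) * (p / q) + (- p) = p * (1 - 1 / p)\<^sup>2 - p" by simp
        also have "\<dots> = - 1 - (1 - 1 / p)" using p by (simp add: power2_eq_square field_simps)
        finally show ?thesis using \<open>1 / q = 1 - 1 / p\<close> by simp
      qed
      have "ennreal (cmod (k t) powr p / t powr p) = ennreal (t powr (- p)) * ennreal (cmod (k t) powr p)"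
        using True by (simp add: powr_minus divide_inverse mult.commute flip: ennreal_mult)
      also have "\<dots> \<le> ennreal (t powr (- p)) * (ennreal ((q * t powr (1 / q)) powr (p / q)) * H t)"
        by (intro mult_left_mono kt True) auto
      also have "\<dots> = ennreal (q powr (p / q) * t powr ((1 / q) * (p / q) + (- p))) * H t"
      proof -
        have "t powr (- p) * (q * t powr (1 / q)) powr (p / q) = t powr (- p) * (q powr (p / q) * t powr ((1 / q) * (p / q)))"
          using q(1) by (simp add: powr_mult powr_powr)
        also have "\<dots> = q powr (p / q) * t powr ((1 / q) * (p / q) + (- p))"
          unfolding powr_add by (simp only: mult_ac)
        finally show ?thesis by (simp only: mult.assoc[symmetric] ennreal_mult[symmetric] powr_ge_zero)
      qed
      also have "\<dots> = ennreal (q powr (p / q) * t powr (- 1 - 1 / q)) * H t" by (simp only: e)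
      also have "\<dots> = (\<integral>\<^sup>+s. ennreal (q powr (p / q) * t powr (- 1 - 1 / q)) * indicator {s..} t *
          (ennreal (cmod (k' s) powr p * s powr (1 / q)) * indicator {0<..} s) \<partial>lborel)"
        unfolding H_def
        by (subst nn_integral_cmult[symmetric]) (auto intro!: nn_integral_cong simp: indicator_def)
      finally show ?thesis using True by simp
    qed simp
  qed
  also have "\<dots> = (\<integral>\<^sup>+s. \<integral>\<^sup>+t. ennreal (q powr (p / q) * t powr (- 1 - 1 / q)) * indicator {s..} t *
          (ennreal (cmod (k' s) powr p * s powr (1 / q)) * indicator {0<..} s) \<partial>lborel \<partial>lborel)"
    by (rule lborel_pair.Fubini') (simp add: indicator_def, measurable)
  also have "\<dots> = (\<integral>\<^sup>+s. ennreal (q powr p) * (ennreal (cmod (k' s) powr p) * indicator {0<..} s) \<partial>lborel)"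
  proof (rule nn_integral_cong)
    fix s :: real
    show "(\<integral>\<^sup>+t. ennreal (q powr (p / q) * t powr (- 1 - 1 / q)) * indicator {s..} t *
          (ennreal (cmod (k' s) powr p * s powr (1 / q)) * indicator {0<..} s) \<partial>lborel)
        = ennreal (q powr p) * (ennreal (cmod (k' s) powr p) * indicator {0<..} s)"
    proof (cases "s > 0")
      case True
      have "(\<integral>\<^sup>+t. ennreal (q powr (p / q) * t powr (- 1 - 1 / q)) * indicator {s..} t *
          (ennreal (cmod (k' s) powr p * s powr (1 / q)) * indicator {0<..} s) \<partial>lborel)
        = (\<integral>\<^sup>+t. (ennreal (q powr (p / q)) * ennreal (cmod (k' s) powr p * s powr (1 / q))) *
            (ennreal (t powr (- 1 - 1 / q)) * indicator {s..} t) \<partial>lborel)"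
        using True by (intro nn_integral_cong) (simp add: ennreal_mult mult_ac)
      also have "\<dots> = (ennreal (q powr (p / q)) * ennreal (cmod (k' s) powr p * s powr (1 / q))) *
            (\<integral>\<^sup>+t. ennreal (t powr (- 1 - 1 / q)) * indicator {s..} t \<partial>lborel)"
        by (rule nn_integral_cmult) measurable
      also have "(\<integral>\<^sup>+t. ennreal (t powr (- 1 - 1 / q)) * indicator {s..} t \<partial>lborel)
          = ennreal (s powr (- 1 - 1 / q + 1) / (- (- 1 - 1 / q) - 1))"
        using True q(1) by (intro nn_integral_powr_atLeast) auto
      also have "\<dots> = ennreal (q * s powr (- (1 / q)))" by (simp add: mult.commute)
      also have "(ennreal (q powr (p / q)) * ennreal (cmod (k' s) powr p * s powr (1 / q))) * ennreal (q * s powr (- (1 / q)))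
          = ennreal ((q powr (p / q) * q powr 1) * cmod (k' s) powr p * (s powr (1 / q) * s powr (- (1 / q))))"
        using q(1) by (simp add: mult_ac flip: ennreal_mult)
      \<comment> \<open>The constants q^(p/q) from Hoelder's inequality and q from the tail combine
        to q^p.\<close>
      also have "q powr (p / q) * q powr 1 = q powr p"
      proof -
        have "p / q + 1 = p" using p by (simp add: q_def field_simps)
        then show ?thesis by (metis powr_add)
      qed
      also have "s powr (1 / q) * s powr (- (1 / q)) = 1" using True by (simp flip: powr_add)
      finally show ?thesis using True by (simp add: ennreal_mult)
    qed simp
  qed
  also have "\<dots> = ennreal (q powr p) * (\<integral>\<^sup>+s. ennreal (cmod (k' s) powr p) * indicator {0<..} s \<partial>lborel)"
    by (rule nn_integral_cmult) measurable
  finally show ?thesis unfolding q_def .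
qed

text \<open>The half-line inequality is applied to \<open>k\<close> and to its reflection, both of
  which vanish at 0. The two halves exhaust the line up to the null set t = 0.\<close>

lemma Hardy_line:
  fixes k k' :: "real \<Rightarrow> complex"
  assumes p: "p > 1" and k: "\<And>t. (k has_vector_derivative k' t) (at t)" and k': "continuous_on UNIV k'" and "k 0 = 0"
  shows "(\<integral>\<^sup>+t. ennreal (cmod (k t) powr p / \<bar>t\<bar> powr p) \<partial>lborel)
    \<le> ennreal ((p / (p - 1)) powr p) * (\<integral>\<^sup>+t. ennreal (cmod (k' t) powr p) \<partial>lborel)"
proof -
  have [measurable]: "k' \<in> borel_measurable borel" using k' by (rule borel_measurable_continuous_onI)
  have [measurable]: "k \<in> borel_measurable borel"
    using k by (intro borel_measurable_continuous_onI continuous_at_imp_continuous_on) (auto dest: has_vector_derivative_continuous)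
  have split: "(\<integral>\<^sup>+t. F t \<partial>lborel) = (\<integral>\<^sup>+t. F t * indicator {0<..} t \<partial>lborel) + (\<integral>\<^sup>+t. F (- t) * indicator {0<..} t \<partial>lborel)"
    if [measurable]: "F \<in> borel_measurable borel" for F :: "real \<Rightarrow> ennreal"
  proof -
    have "(\<integral>\<^sup>+t. F t \<partial>lborel) = (\<integral>\<^sup>+t. F t * indicator {0<..} t + F t * indicator {..<0} t \<partial>lborel)"
      by (intro nn_integral_cong_AE) (use AE_lborel_singleton[of "0::real"] in eventually_elim, auto simp: indicator_def)
    also have "\<dots> = (\<integral>\<^sup>+t. F t * indicator {0<..} t \<partial>lborel) + (\<integral>\<^sup>+t. F t * indicator {..<0} t \<partial>lborel)"
      by (rule nn_integral_add) auto
    also have "(\<integral>\<^sup>+t. F t * indicator {..<0} t \<partial>lborel) = (\<integral>\<^sup>+t. F (- t) * indicator {..<0} (- t) \<partial>lborel)"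
      using nn_integral_real_affine[of "\<lambda>t. F t * indicator {..<0} t" "-1" 0] by simp
    also have "\<dots> = (\<integral>\<^sup>+t. F (- t) * indicator {0<..} t \<partial>lborel)"
      by (intro nn_integral_cong) (auto simp: indicator_def)
    finally show ?thesis .
  qed
  have c: "continuous_on UNIV (\<lambda>t. - k' (- t))"
    by (intro continuous_intros continuous_on_compose2[OF k']) auto
  have "((\<lambda>t. k (- t)) has_vector_derivative - k' (- t)) (at t)" for t
  proof -
    have "(uminus has_vector_derivative - 1) (at t)"
      unfolding has_real_derivative_iff_has_vector_derivative[symmetric]
      by (auto intro!: derivative_eq_intros)
    from vector_diff_chain_at[OF this k] show ?thesis by (simp add: o_def)
  qed
  from Hardy_half_line[OF p this c] have neg: "(\<integral>\<^sup>+t. ennreal (cmod (k (- t)) powr p / t powr p) * indicator {0<..} t \<partial>lborel)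
    \<le> ennreal ((p / (p - 1)) powr p) * (\<integral>\<^sup>+t. ennreal (cmod (k' (- t)) powr p) * indicator {0<..} t \<partial>lborel)"
    using \<open>k 0 = 0\<close> by simp
  have "(\<integral>\<^sup>+t. ennreal (cmod (k t) powr p / \<bar>t\<bar> powr p) \<partial>lborel)
      = (\<integral>\<^sup>+t. ennreal (cmod (k t) powr p / t powr p) * indicator {0<..} t \<partial>lborel)
      + (\<integral>\<^sup>+t. ennreal (cmod (k (- t)) powr p / t powr p) * indicator {0<..} t \<partial>lborel)"
    by (subst split) (auto intro!: arg_cong2[of _ _ _ _ "(+)"] nn_integral_cong simp: indicator_def)
  also have "\<dots> \<le> ennreal ((p / (p - 1)) powr p) * (\<integral>\<^sup>+t. ennreal (cmod (k' t) powr p) * indicator {0<..} t \<partial>lborel)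
      + ennreal ((p / (p - 1)) powr p) * (\<integral>\<^sup>+t. ennreal (cmod (k' (- t)) powr p) * indicator {0<..} t \<partial>lborel)"
    by (intro add_mono neg Hardy_half_line assms)
  also have "\<dots> = ennreal ((p / (p - 1)) powr p) * (\<integral>\<^sup>+t. ennreal (cmod (k' t) powr p) \<partial>lborel)"
    by (subst (3) split) (auto simp: distrib_left)
  finally show ?thesis .
qed

section \<open>Averaging over dilation orbits\<close>

locale homogeneous_norm_group = homogeneous_lie_group \<A> L e A
  for \<A> :: "('g::{topological_group_add,t2_space,second_countable_topology}, 'a::euclidean_space) chart set"
    and L :: "'a \<Rightarrow> 'g vfield" and e :: "'a \<Rightarrow> 'g" and A :: "'a \<Rightarrow> 'a" +
  fixes N :: "'g \<Rightarrow> real" and M :: "'g measure"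
  assumes quasi_norm: "homogeneous_quasi_norm (group_dilation e A) N"
    and haar: "haar_measure M"
begin

abbreviation \<delta> :: "real \<Rightarrow> 'g \<Rightarrow> 'g" where "\<delta> \<equiv> group_dilation e A"
abbreviation Q :: real where "Q \<equiv> operator_trace A"

lemma N_nonneg: "N x \<ge> 0" and N_dilation: "r > 0 \<Longrightarrow> N (\<delta> r x) = r * N x"
  and N_eq_0_iff: "N x = 0 \<longleftrightarrow> x = 0" and continuous_N: "continuous_on UNIV N"
  using quasi_norm by (auto simp: homogeneous_quasi_norm_def)

lemma borel_N [measurable]: "N \<in> borel_measurable borel"
  by (intro borel_measurable_continuous_onI continuous_N)

lemma sets_haar [measurable_cong]: "sets M = sets borel"
  using haar by (simp add: haar_measure_def)

lemma group_dilation_comp: "r > 0 \<Longrightarrow> s > 0 \<Longrightarrow> \<delta> r (\<delta> s x) = \<delta> (r * s) x"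
  by (simp add: group_dilation_def dilation_dilation)

lemma group_dilation_one [simp]: "\<delta> 1 x = x"
  by (simp add: group_dilation_def dilation_one)

text \<open>Dilations in logarithmic time: an action of the additive group of the reals, along which
  \<open>ln (N x)\<close> grows at unit speed off the unit element.\<close>

definition flow :: "real \<Rightarrow> 'g \<Rightarrow> 'g" where
  "flow t x = \<delta> (exp t) x"

lemma flow_flow: "flow s (flow t x) = flow (s + t) x"
  by (simp add: flow_def group_dilation_comp exp_add)

lemma flow_zero [simp]: "flow 0 x = x"
  by (simp add: flow_def)

lemma flow_ln: "r > 0 \<Longrightarrow> flow (ln r) x = \<delta> r x"
  by (simp add: flow_def)

lemma N_flow: "N (flow t x) = exp t * N x"
  by (simp add: flow_def N_dilation)

lemma continuous_flow: "continuous_on UNIV (\<lambda>z. flow (fst z) (snd z))"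
  unfolding flow_def group_dilation_def
  by (intro continuous_on_compose2[OF continuous_e]
      continuous_on_compose2[OF continuous_dilation, where f="\<lambda>z. (fst z, inv e (snd z))", simplified]
      continuous_intros continuous_on_compose2[OF continuous_inv_e]) auto

lemma measurable_flow [measurable (raw)]:
  assumes "a \<in> borel_measurable K" "b \<in> measurable K borel"
  shows "(\<lambda>z. flow (a z) (b z)) \<in> measurable K borel"
proof -
  have "(\<lambda>z. flow (fst z) (snd z)) \<in> borel_measurable (borel \<Otimes>\<^sub>M borel)"
    unfolding borel_prod by (intro borel_measurable_continuous_onI continuous_flow)
  from measurable_compose[OF measurable_Pair[OF assms] this] show ?thesis by simp
qed

lemma nn_integral_flow:
  assumes "F \<in> borel_measurable borel"
  shows "(\<integral>\<^sup>+x. F x \<partial>M) = ennreal (exp t powr Q) * (\<integral>\<^sup>+x. F (flow t x) \<partial>M)"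
  unfolding flow_def by (rule haar_measure_dilation[OF haar assms]) simp

text \<open>This replaces polar coordinates: the weight \<open>N x powr (- Q)\<close> turns \<open>M\<close> into a measure
  invariant under the flow, and every orbit spends unit time in the shell \<open>0 \<le> ln (N x) < 1\<close>.\<close>

lemma orbit_average:
  assumes F [measurable]: "F \<in> borel_measurable borel"
  shows "(\<integral>\<^sup>+x. F x * ennreal (N x powr (- Q)) \<partial>M)
    = (\<integral>\<^sup>+x. (\<integral>\<^sup>+t. F (flow t x) \<partial>lborel) * (ennreal (N x powr (- Q)) * indicator {0..<1} (ln (N x))) \<partial>M)"
proof -
  interpret M: sigma_finite_measure M by (rule sigma_finite_haar[OF haar])
  interpret P: pair_sigma_finite M lborel ..
  have [measurable]: "(indicator {0..<1::real} :: real \<Rightarrow> ennreal) \<in> borel_measurable borel"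
    by (rule borel_measurable_indicator) simp
  have one: "(\<integral>\<^sup>+t. indicator {0..<1} (l - t) \<partial>lborel) = (1 :: ennreal)" for l :: real
  proof -
    have "(\<integral>\<^sup>+t. indicator {0..<1} (l - t) \<partial>lborel) = (\<integral>\<^sup>+t. indicator {l - 1<..l} t \<partial>(lborel :: real measure))"
      by (intro nn_integral_cong) (auto simp: indicator_def)
    then show ?thesis by simp
  qed
  have "(\<integral>\<^sup>+x. F x * ennreal (N x powr (- Q)) \<partial>M)
      = (\<integral>\<^sup>+x. \<integral>\<^sup>+t. F x * ennreal (N x powr (- Q)) * indicator {0..<1} (ln (N x) - t) \<partial>lborel \<partial>M)"
    by (intro nn_integral_cong, subst nn_integral_cmult) (simp_all add: one)
  also have "\<dots> = (\<integral>\<^sup>+t. \<integral>\<^sup>+x. F x * ennreal (N x powr (- Q)) * indicator {0..<1} (ln (N x) - t) \<partial>M \<partial>lborel)"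
    by (rule P.Fubini'[symmetric]) measurable
  \<comment> \<open>Replacing \<open>x\<close> by \<open>flow t x\<close> moves the time from the
    shell to \<open>F\<close>: the Jacobian \<open>exp t powr Q\<close> cancels the change of the
    weight, and \<open>ln (N x)\<close> grows by exactly \<open>t\<close>.\<close>
  also have "\<dots> = (\<integral>\<^sup>+t. \<integral>\<^sup>+x. F (flow t x) * (ennreal (N x powr (- Q)) * indicator {0..<1} (ln (N x))) \<partial>M \<partial>lborel)"
  proof (rule nn_integral_cong)
    fix t :: real
    have "(\<integral>\<^sup>+x. F x * ennreal (N x powr (- Q)) * indicator {0..<1} (ln (N x) - t) \<partial>M)
      = ennreal (exp t powr Q) *
        (\<integral>\<^sup>+x. F (flow t x) * ennreal (N (flow t x) powr (- Q)) * indicator {0..<1} (ln (N (flow t x)) - t) \<partial>M)"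
      by (rule nn_integral_flow) measurable
    also have "\<dots> = (\<integral>\<^sup>+x. ennreal (exp t powr Q) *
        (F (flow t x) * ennreal (N (flow t x) powr (- Q)) * indicator {0..<1} (ln (N (flow t x)) - t)) \<partial>M)"
      by (rule nn_integral_cmult[symmetric]) measurable
    also have "\<dots> = (\<integral>\<^sup>+x. F (flow t x) * (ennreal (N x powr (- Q)) * indicator {0..<1} (ln (N x))) \<partial>M)"
    proof (rule nn_integral_cong)
      fix x
      have "exp t powr Q * (exp t * N x) powr (- Q) = N x powr (- Q)"
        using N_nonneg[of x] by (simp add: powr_mult flip: powr_add mult.assoc)
      then have 1: "ennreal (exp t powr Q) * ennreal (N (flow t x) powr (- Q)) = ennreal (N x powr (- Q))"
        by (simp add: N_flow flip: ennreal_mult)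
      \<comment> \<open>At the unit \<open>0 powr (- Q) = 0\<close> annihilates both sides, whatever
        value \<open>ln 0\<close> has.\<close>
      have 2: "ennreal (N x powr (- Q)) * indicator {0..<1} (ln (N (flow t x)) - t)
          = (ennreal (N x powr (- Q)) * indicator {0..<1} (ln (N x)) :: ennreal)"
        using N_nonneg[of x] by (cases "N x = 0") (simp_all add: N_flow ln_mult)
      have "ennreal (exp t powr Q) *
          (F (flow t x) * ennreal (N (flow t x) powr (- Q)) * indicator {0..<1} (ln (N (flow t x)) - t))
        = F (flow t x) * (ennreal (exp t powr Q) * ennreal (N (flow t x) powr (- Q))
          * indicator {0..<1} (ln (N (flow t x)) - t))"
        by (simp only: mult_ac)
      then show "ennreal (exp t powr Q) *
          (F (flow t x) * ennreal (N (flow t x) powr (- Q)) * indicator {0..<1} (ln (N (flow t x)) - t))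
        = F (flow t x) * (ennreal (N x powr (- Q)) * indicator {0..<1} (ln (N x)))"
        by (simp only: 1 2)
    qed
    finally show "(\<integral>\<^sup>+x. F x * ennreal (N x powr (- Q)) * indicator {0..<1} (ln (N x) - t) \<partial>M)
      = (\<integral>\<^sup>+x. F (flow t x) * (ennreal (N x powr (- Q)) * indicator {0..<1} (ln (N x))) \<partial>M)" .
  qed
  also have "\<dots> = (\<integral>\<^sup>+x. \<integral>\<^sup>+t. F (flow t x) * (ennreal (N x powr (- Q)) * indicator {0..<1} (ln (N x))) \<partial>lborel \<partial>M)"
    by (rule P.Fubini') measurable
  also have "\<dots> = (\<integral>\<^sup>+x. (\<integral>\<^sup>+t. F (flow t x) \<partial>lborel) * (ennreal (N x powr (- Q)) * indicator {0..<1} (ln (N x))) \<partial>M)"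
    by (intro nn_integral_cong nn_integral_multc) measurable
  finally show ?thesis .
qed

text \<open>The derivative along the flow, i.e. \<open>N x\<close> times the radial operator.\<close>

definition euler :: "('g \<Rightarrow> complex) \<Rightarrow> 'g \<Rightarrow> complex" where
  "euler f x = frechet_derivative (\<lambda>v. f (e v)) (at (inv e x)) (A (inv e x))"

context
  fixes f :: "'g \<Rightarrow> complex"
  assumes f: "smooth_fun \<A> f"
begin

lemma has_vector_derivative_flow:
  "((\<lambda>t. f (flow t x)) has_vector_derivative euler f (flow t x)) (at t)"
proof -
  have d: "((\<lambda>t. D (exp t) (inv e x)) has_derivative (\<lambda>h. h *\<^sub>R A (D (exp t) (inv e x)))) (at t)"
    using dilation_flow by (simp add: has_vector_derivative_def)
  have g: "((\<lambda>v. f (e v)) has_derivative frechet_derivative (\<lambda>v. f (e v)) (at v)) (at v)" for v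
    using smooth_on_imp_has_derivative[OF f[unfolded smooth_fun_iff]] by simp
  have l: "linear (frechet_derivative (\<lambda>v. f (e v)) (at v))" for v
    using has_derivative_linear[OF g] .
  from has_derivative_compose[OF d g] show ?thesis
    by (simp add: has_vector_derivative_def euler_def flow_def group_dilation_def linear_cmul[OF l])
qed

lemma continuous_f: "continuous_on UNIV f"
proof -
  have "continuous_on UNIV (\<lambda>x. f (e (inv e x)))"
    by (rule continuous_on_compose2[OF smooth_on_imp_continuous_on[OF f[unfolded smooth_fun_iff]] continuous_inv_e]) auto
  then show ?thesis by simp
qed

lemma borel_f [measurable]: "f \<in> borel_measurable borel"
  by (intro borel_measurable_continuous_onI continuous_f)

lemma continuous_euler: "continuous_on UNIV (euler f)"
proof -
  have F: "smooth_on UNIV (\<lambda>v. f (e v))" using f by (simp add: smooth_fun_iff)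
  have "continuous_on UNIV (\<lambda>v. \<Sum>b\<in>Basis. (A v \<bullet> b) *\<^sub>R frechet_derivative (\<lambda>v. f (e v)) (at v) b)"
    by (intro continuous_intros smooth_on_imp_continuous_on[OF smooth_on_frechet_derivative[OF F]]
        linear_continuous_on linear_generator[unfolded linear_conv_bounded_linear])
  moreover have "(\<lambda>v. frechet_derivative (\<lambda>v. f (e v)) (at v) (A v))
      = (\<lambda>v. \<Sum>b\<in>Basis. (A v \<bullet> b) *\<^sub>R frechet_derivative (\<lambda>v. f (e v)) (at v) b)"
    by (rule ext, rule frechet_derivative_euclidean, rule smooth_on_imp_differentiable[OF F UNIV_I])
  ultimately have "continuous_on UNIV (\<lambda>v. frechet_derivative (\<lambda>v. f (e v)) (at v) (A v))"
    by (simp only:)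
  from continuous_on_compose2[OF this continuous_inv_e] show ?thesis
    by (simp add: euler_def[abs_def])
qed

lemma borel_euler [measurable]: "euler f \<in> borel_measurable borel"
  by (intro borel_measurable_continuous_onI continuous_euler)

text \<open>For \<open>r > 0\<close> the point \<open>\<delta> r (\<delta> (1 / N x) x)\<close> is
  \<open>flow (ln (r / N x)) x\<close>, and this change of time has derivative 1 / N x at
  \<open>r = N x\<close>, where the time is 0.\<close>

lemma radial_operator_euler:
  assumes "N x \<noteq> 0" shows "radial_operator \<delta> N f x = euler f x / of_real (N x)"
proof -
  have N: "N x > 0" using assms N_nonneg[of x] by simp
  have ln: "((\<lambda>r. ln (r / N x)) has_vector_derivative 1 / N x) (at (N x))"
    unfolding has_real_derivative_iff_has_vector_derivative[symmetric]
    using N by (auto intro!: derivative_eq_intros)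
  have "((\<lambda>t. f (flow t x)) has_vector_derivative euler f x) (at (ln (N x / N x)))"
    using has_vector_derivative_flow[of x 0] N by simp
  from vector_diff_chain_at[OF ln this]
  have "((\<lambda>r. f (flow (ln (r / N x)) x)) has_vector_derivative (1 / N x) *\<^sub>R euler f x) (at (N x))"
    by (simp add: o_def)
  then have "((\<lambda>r. f (\<delta> r (\<delta> (1 / N x) x))) has_vector_derivative (1 / N x) *\<^sub>R euler f x) (at (N x))"
    by (rule has_vector_derivative_transform_within_open[of _ _ _ "{0<..}"])
      (use N in \<open>auto simp: flow_ln group_dilation_comp\<close>)
  then have "radial_operator \<delta> N f x = (1 / N x) *\<^sub>R euler f x"
    unfolding radial_operator_def by (rule vector_derivative_at)
  then show ?thesis by (simp add: scaleR_conv_of_real field_simps)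
qed

lemma borel_radial_freeze [measurable]:
  assumes "R > 0" shows "radial_freeze \<delta> N R f \<in> borel_measurable borel"
proof -
  have "radial_freeze \<delta> N R f x = (if N x = 0 then radial_freeze \<delta> N R f 0 else f (flow (ln (R / N x)) x))" for x
  proof (cases "N x = 0")
    case True then show ?thesis by (simp add: N_eq_0_iff)
  next
    case False
    with N_nonneg[of x] have "R / N x > 0" using assms by simp
    then show ?thesis using False by (simp add: radial_freeze_def flow_ln)
  qed
  then have "radial_freeze \<delta> N R f = (\<lambda>x. if N x = 0 then radial_freeze \<delta> N R f 0 else f (flow (ln (R / N x)) x))"
    by (rule ext)
  moreover have "(\<lambda>x. if N x = 0 then radial_freeze \<delta> N R f 0 else f (flow (ln (R / N x)) x)) \<in> borel_measurable borel"
    by measurable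
  ultimately show ?thesis by simp
qed

text \<open>Time is counted from \<open>y\<close>, the point on the sphere \<open>N y = R\<close>
  that the orbit of \<open>x\<close> reaches at time \<open>s\<close>. There \<open>k\<close>
  vanishes, which is the boundary condition of \<open>Hardy_line\<close>; the shift by
  \<open>s\<close> leaves both integrals unchanged.\<close>

lemma Hardy_orbit:
  assumes p: "p > 1" and R: "R > 0" and x: "N x \<noteq> 0"
  shows "(\<integral>\<^sup>+t. ennreal (cmod (f (flow t x) - radial_freeze \<delta> N R f (flow t x)) powr p / \<bar>ln (R / N (flow t x))\<bar> powr p) \<partial>lborel)
    \<le> ennreal ((p / (p - 1)) powr p) * (\<integral>\<^sup>+t. ennreal (cmod (euler f (flow t x)) powr p) \<partial>lborel)"
proof -
  have N: "N x > 0" using x N_nonneg[of x] by simp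
  define s where "s = ln (R / N x)"
  define y where "y = flow s x"
  define k where "k t = f (flow t y) - f y" for t
  have xy: "flow t x = flow (t - s) y" for t by (simp add: y_def flow_flow)
  have Ny: "N y = R" using N R by (simp add: y_def s_def N_flow)
  have fr: "radial_freeze \<delta> N R f (flow t x) = f y" for t
  proof -
    have "radial_freeze \<delta> N R f (flow t x) = f (flow (ln (R / N (flow t x))) (flow t x))"
      using N R by (simp add: radial_freeze_def flow_ln N_flow)
    also have "ln (R / N (flow t x)) = s - t"
      using N R by (simp add: N_flow s_def ln_div ln_mult)
    finally show ?thesis by (simp add: flow_flow y_def)
  qed
  have lnN: "\<bar>ln (R / N (flow t x))\<bar> = \<bar>t - s\<bar>" for t
    using N R by (simp add: N_flow s_def ln_div ln_mult)
  have cont: "continuous_on UNIV (\<lambda>t. euler f (flow t y))"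
    by (rule continuous_on_compose2[OF continuous_euler])
      (auto intro!: continuous_on_compose2[OF continuous_flow, where f="\<lambda>t. (t, y)", simplified] continuous_intros)
  have k': "(k has_vector_derivative euler f (flow t y)) (at t)" for t
    unfolding k_def using has_vector_derivative_diff[OF has_vector_derivative_flow has_vector_derivative_const] by simp
  have [measurable]: "(\<lambda>t. euler f (flow t y)) \<in> borel_measurable borel" "k \<in> borel_measurable borel"
    unfolding k_def by measurable
  have shift: "(\<integral>\<^sup>+t. F (t - s) \<partial>lborel) = (\<integral>\<^sup>+t. F t \<partial>lborel)"
    if "F \<in> borel_measurable borel" for F :: "real \<Rightarrow> ennreal"
    using nn_integral_real_affine[OF that, of 1 "- s"] by simp
  have "(\<integral>\<^sup>+t. ennreal (cmod (f (flow t x) - radial_freeze \<delta> N R f (flow t x)) powr p / \<bar>ln (R / N (flow t x))\<bar> powr p) \<partial>lborel)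
      = (\<integral>\<^sup>+t. ennreal (cmod (k (t - s)) powr p / \<bar>t - s\<bar> powr p) \<partial>lborel)"
    unfolding fr lnN unfolding xy k_def ..
  also have "\<dots> = (\<integral>\<^sup>+t. ennreal (cmod (k t) powr p / \<bar>t\<bar> powr p) \<partial>lborel)"
    by (rule shift[of "\<lambda>t. ennreal (cmod (k t) powr p / \<bar>t\<bar> powr p)"]) measurable
  also have "\<dots> \<le> ennreal ((p / (p - 1)) powr p) * (\<integral>\<^sup>+t. ennreal (cmod (euler f (flow t y)) powr p) \<partial>lborel)"
    by (rule Hardy_line[OF p k' cont]) (simp add: k_def)
  also have "(\<integral>\<^sup>+t. ennreal (cmod (euler f (flow t y)) powr p) \<partial>lborel)
      = (\<integral>\<^sup>+t. ennreal (cmod (euler f (flow (t - s) y)) powr p) \<partial>lborel)"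
    by (rule shift[symmetric]) measurable
  finally show ?thesis unfolding xy .
qed

text \<open>Taking p-th powers produces the weight \<open>N x powr (- Q)\<close> on either side, for
  the radial term because N^(1 - Q/p) Rf is N^(-Q/p) times the derivative along the flow.
  \<open>orbit_average\<close> then reduces the claim to \<open>Hardy_orbit\<close>.\<close>

lemma critical_Hardy:
  assumes p: "p > 1" and R: "R > 0"
  shows "ennreal ((p - 1) / p) * Lp_norm M p (\<lambda>x. (f x - radial_freeze \<delta> N R f x) / of_real (N x powr (Q / p) * ln (R / N x)))
    \<le> Lp_norm M p (\<lambda>x. radial_operator \<delta> N f x / of_real (N x powr (Q / p - 1)))"
proof -
  note [measurable] = borel_radial_freeze[OF R]
  define C where "C = p / (p - 1)"
  have C: "C > 0" "(p - 1) / p * C = 1" using p by (auto simp: C_def)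
  define F where "F x = ennreal (cmod (f x - radial_freeze \<delta> N R f x) powr p / \<bar>ln (R / N x)\<bar> powr p)" for x
  define E where "E x = ennreal (cmod (euler f x) powr p)" for x
  have [measurable]: "F \<in> borel_measurable borel" "E \<in> borel_measurable borel"
    unfolding F_def E_def by measurable
  have Np: "(N x powr (Q / p)) powr p = N x powr Q" for x using p by (simp add: powr_powr)
  have "(\<integral>\<^sup>+x. ennreal (cmod ((f x - radial_freeze \<delta> N R f x) / of_real (N x powr (Q / p) * ln (R / N x))) powr p) \<partial>M)
      = (\<integral>\<^sup>+x. F x * ennreal (N x powr (- Q)) \<partial>M)"
  proof (rule nn_integral_cong)
    fix x
    have "cmod ((f x - radial_freeze \<delta> N R f x) / of_real (N x powr (Q / p) * ln (R / N x))) powr p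
      = cmod (f x - radial_freeze \<delta> N R f x) powr p / \<bar>ln (R / N x)\<bar> powr p * N x powr (- Q)"
      by (simp add: norm_divide norm_mult powr_divide powr_mult Np) (simp add: powr_minus divide_inverse mult_ac)
    then show "ennreal (cmod ((f x - radial_freeze \<delta> N R f x) / of_real (N x powr (Q / p) * ln (R / N x))) powr p)
      = F x * ennreal (N x powr (- Q))" by (simp add: F_def flip: ennreal_mult)
  qed
  also have "\<dots> = (\<integral>\<^sup>+x. (\<integral>\<^sup>+t. F (flow t x) \<partial>lborel) * (ennreal (N x powr (- Q)) * indicator {0..<1} (ln (N x))) \<partial>M)"
    by (rule orbit_average) measurable
  also have "\<dots> \<le> (\<integral>\<^sup>+x. ennreal (C powr p) *
      ((\<integral>\<^sup>+t. E (flow t x) \<partial>lborel) * (ennreal (N x powr (- Q)) * indicator {0..<1} (ln (N x)))) \<partial>M)"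
  proof (rule nn_integral_mono)
    fix x
    show "(\<integral>\<^sup>+t. F (flow t x) \<partial>lborel) * (ennreal (N x powr (- Q)) * indicator {0..<1} (ln (N x)))
      \<le> ennreal (C powr p) * ((\<integral>\<^sup>+t. E (flow t x) \<partial>lborel) * (ennreal (N x powr (- Q)) * indicator {0..<1} (ln (N x))))"
    \<comment> \<open>At the unit the left-hand side is 0, since
      \<open>0 powr (- Q) = 0\<close>.\<close>
    proof (cases "N x = 0")
      case False
      from mult_right_mono[OF Hardy_orbit[OF p R False]] show ?thesis
        by (simp add: F_def E_def C_def mult.assoc)
    qed simp
  qed
  also have "\<dots> = ennreal (C powr p) * (\<integral>\<^sup>+x. (\<integral>\<^sup>+t. E (flow t x) \<partial>lborel) * (ennreal (N x powr (- Q)) * indicator {0..<1} (ln (N x))) \<partial>M)"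
    by (rule nn_integral_cmult) measurable
  also have "(\<integral>\<^sup>+x. (\<integral>\<^sup>+t. E (flow t x) \<partial>lborel) * (ennreal (N x powr (- Q)) * indicator {0..<1} (ln (N x))) \<partial>M)
      = (\<integral>\<^sup>+x. E x * ennreal (N x powr (- Q)) \<partial>M)"
    by (rule orbit_average[symmetric]) measurable
  also have "\<dots> = (\<integral>\<^sup>+x. ennreal (cmod (radial_operator \<delta> N f x / of_real (N x powr (Q / p - 1))) powr p) \<partial>M)"
  proof (rule nn_integral_cong)
    fix x
    show "E x * ennreal (N x powr (- Q)) = ennreal (cmod (radial_operator \<delta> N f x / of_real (N x powr (Q / p - 1))) powr p)"
    \<comment> \<open>At the unit both sides are 0: on the left by \<open>0 powr (- Q) = 0\<close>,
      on the right because the divisor is 0.\<close>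
    proof (cases "N x = 0")
      case False
      then have N: "N x > 0" using N_nonneg[of x] by simp
      have "N x powr 1 * N x powr (Q / p - 1) = N x powr (Q / p)" by (simp only: flip: powr_add) simp
      then have "radial_operator \<delta> N f x / of_real (N x powr (Q / p - 1)) = euler f x / of_real (N x powr (Q / p))"
        using N by (simp add: radial_operator_euler flip: of_real_mult)
      then have "cmod (radial_operator \<delta> N f x / of_real (N x powr (Q / p - 1))) powr p = cmod (euler f x) powr p * N x powr (- Q)"
        by (simp add: norm_divide powr_divide Np) (simp add: powr_minus divide_inverse)
      then show ?thesis by (simp add: E_def ennreal_mult)
    qed simp
  qed
  finally have "Lp_norm M p (\<lambda>x. (f x - radial_freeze \<delta> N R f x) / of_real (N x powr (Q / p) * ln (R / N x)))
    \<le> epow (ennreal (C powr p)) (1 / p) * Lp_norm M p (\<lambda>x. radial_operator \<delta> N f x / of_real (N x powr (Q / p - 1)))"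
    unfolding Lp_norm_epow epow_mult[symmetric] using p by (intro epow_mono) auto
  also have "epow (ennreal (C powr p)) (1 / p) = ennreal C" using C(1) p by (simp add: powr_powr)
  finally have "ennreal ((p - 1) / p) * Lp_norm M p (\<lambda>x. (f x - radial_freeze \<delta> N R f x) / of_real (N x powr (Q / p) * ln (R / N x)))
    \<le> (ennreal ((p - 1) / p) * ennreal C) * Lp_norm M p (\<lambda>x. radial_operator \<delta> N f x / of_real (N x powr (Q / p - 1)))"
    unfolding mult.assoc by (rule mult_left_mono) simp
  also have "ennreal ((p - 1) / p) * ennreal C = 1" using p C by (simp flip: ennreal_mult)
  finally show ?thesis by simp
qed

end

end

section \<open>Product inequalities from the critical Hardy inequality\<close>

theorem corollary3p2:
  fixes \<A> :: "('g::{topological_group_add,t2_space,second_countable_topology}, 'a::euclidean_space) chart set"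
    and L :: "'a \<Rightarrow> 'g vfield"
    and e :: "'a \<Rightarrow> 'g"
    and A :: "'a \<Rightarrow> 'a"
    and \<delta> :: "real \<Rightarrow> 'g \<Rightarrow> 'g"
    and N :: "'g \<Rightarrow> real"
    and M :: "'g measure"
    and Q p R :: real
    and f f\<^sub>R :: "'g \<Rightarrow> complex"
  assumes "homogeneous_group \<A> L e A"
    and "\<delta> = group_dilation e A"
    and "Q = operator_trace A" and "Q \<ge> 2"
    and "homogeneous_quasi_norm \<delta> N"
    and "haar_measure M"
    and "1 < p"
    and "f \<in> test_functions \<A> (UNIV - {0})"
    and "R > 0"
    and "f\<^sub>R = radial_freeze \<delta> N R f"
  shows "(\<forall>q>1. 1 / p + 1 / q = 1 / 2 \<longrightarrow>
           Lp_norm M p (\<lambda>x. radial_operator \<delta> N f x / of_real (N x powr (Q / p - 1)))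
             * Lp_norm M q f
           \<ge> ennreal ((p - 1) / p)
             * Lp_norm M 2 (\<lambda>x. f x * (f x - f\<^sub>R x) / of_real (N x powr (Q / p) * ln (R / N x)))) \<and>
         (\<forall>p'. 1 / p + 1 / p' = 1 \<longrightarrow>
           Lp_norm M p (\<lambda>x. radial_operator \<delta> N f x / of_real (N x powr (Q / p - 1)))
             * Lp_norm M p' (\<lambda>x. (f x - f\<^sub>R x) / of_real (N x powr (Q / p') * ln (R / N x)))
           \<ge> ennreal ((p - 1) / p)
             * (Lp_norm M 2 (\<lambda>x. (f x - f\<^sub>R x) / of_real (N x powr (Q / 2) * ln (R / N x))))\<^sup>2)"
proof -
  interpret homogeneous_norm_group \<A> L e A N M
    using assms by unfold_locales auto
  have f: "smooth_fun \<A> f" using assms(8) by (simp add: test_functions_def)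
  note [measurable] = borel_f[OF f] borel_radial_freeze[OF f assms(9)]
  define u where "u s = (\<lambda>x. (f x - f\<^sub>R x) / complex_of_real (N x powr (Q / s) * ln (R / N x)))" for s
  have [measurable]: "u s \<in> borel_measurable M" "f \<in> borel_measurable M" for s
    unfolding u_def assms(2,10) by measurable
  let ?Rf = "Lp_norm M p (\<lambda>x. radial_operator \<delta> N f x / of_real (N x powr (Q / p - 1)))"
  have Hardy: "ennreal ((p - 1) / p) * Lp_norm M p (u p) \<le> ?Rf"
    using critical_Hardy[OF f assms(7,9)] by (simp add: u_def assms(2,3,10))
  \<comment> \<open>Both claims are instances: \<open>r = 2\<close> with \<open>v = f\<close>, and
    \<open>r = 1\<close> with \<open>v = u p'\<close>.\<close>
  have key: "ennreal ((p - 1) / p) * Lp_norm M r (\<lambda>x. u p x * v x) \<le> ?Rf * Lp_norm M s v"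
    if "s > 0" "r > 0" "1 / p + 1 / s = 1 / r" "v \<in> borel_measurable M" for r s v
  proof -
    have "Lp_norm M r (\<lambda>x. u p x * v x) \<le> Lp_norm M p (u p) * Lp_norm M s v"
      using that assms(7) by (intro Hoelder_Lp_norm) auto
    then have "ennreal ((p - 1) / p) * Lp_norm M r (\<lambda>x. u p x * v x)
        \<le> ennreal ((p - 1) / p) * Lp_norm M p (u p) * Lp_norm M s v"
      unfolding mult.assoc by (rule mult_left_mono) simp
    also have "\<dots> \<le> ?Rf * Lp_norm M s v" by (intro mult_right_mono Hardy) simp
    finally show ?thesis .
  qed
  show ?thesis
  proof (intro conjI allI impI)
    fix q :: real assume q: "1 < q" "1 / p + 1 / q = 1 / 2"
    have "(\<lambda>x. f x * (f x - f\<^sub>R x) / of_real (N x powr (Q / p) * ln (R / N x))) = (\<lambda>x. u p x * f x)"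
      by (simp add: u_def fun_eq_iff)
    then show "ennreal ((p - 1) / p) * Lp_norm M 2 (\<lambda>x. f x * (f x - f\<^sub>R x) / of_real (N x powr (Q / p) * ln (R / N x)))
        \<le> ?Rf * Lp_norm M q f"
      using key[of q 2 f] q by simp
  next
    fix p' :: real assume p': "1 / p + 1 / p' = 1"
    have "1 / p < 1" using assms(7) by simp
    \<comment> \<open>This includes p' \<noteq> 0: with \<open>1 / 0 = 0\<close>, p' = 0 would force
      1 / p = 1.\<close>
    then have "p' > 0" using p' by (smt (verit) divide_nonneg_nonpos)
    have "Q / p + Q / p' = Q" using arg_cong[OF p', of "\<lambda>z. Q * z"] by (simp add: distrib_left)
    \<comment> \<open>The weights N^(Q/p) and N^(Q/p') multiply to N^Q, so the product of
      \<open>u p\<close> and \<open>u p'\<close> has the modulus of the square of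
      \<open>u 2\<close>, and its L^1 norm is a squared L^2 norm.\<close>
    have "(Lp_norm M 2 (u 2))\<^sup>2 = Lp_norm M 1 (\<lambda>x. u p x * u p' x)"
    proof -
      have "cmod (u p x * u p' x) = cmod (u 2 x) powr 2" for x
      proof -
        have "N x powr (Q / p) * N x powr (Q / p') = N x powr (Q / 2) * N x powr (Q / 2)"
          using \<open>Q / p + Q / p' = Q\<close> by (simp flip: powr_add)
        then show ?thesis
          by (simp add: u_def norm_mult norm_divide power2_eq_square mult_ac)
      qed
      moreover have "(epow I (1 / 2))\<^sup>2 = I" for I
        unfolding power2_eq_square epow_mult[symmetric]
        by (cases I) (auto simp: ennreal_mult_top powr_mult simp flip: ennreal_mult powr_add)
      ultimately show ?thesis by (simp add: Lp_norm_epow)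
    qed
    then have "ennreal ((p - 1) / p) * (Lp_norm M 2 (u 2))\<^sup>2 \<le> ?Rf * Lp_norm M p' (u p')"
      using key[of p' 1 "u p'"] p' \<open>p' > 0\<close> by simp
    then show "ennreal ((p - 1) / p) * (Lp_norm M 2 (\<lambda>x. (f x - f\<^sub>R x) / of_real (N x powr (Q / 2) * ln (R / N x))))\<^sup>2
        \<le> ?Rf * Lp_norm M p' (\<lambda>x. (f x - f\<^sub>R x) / of_real (N x powr (Q / p') * ln (R / N x)))"
      unfolding u_def .
  qed
qed

end
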